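(* Let $(U_h^n)_{0\le n\le N}\subset\mathcal{V}_h(\mathbb{C})$ and $(\Phi_h^{n+\frac12})_{-1\le n\le N-1}\subset\mathcal{V}_h(\mathbb{R})$ satisfy the fully discrete relaxation scheme: $U_h^0=\mathcal{P}_hu_0$, $k_{-1}=k_0$, $\Phi_h^{-\frac12}=\mathcal{P}_h(|u_0|^2)$ and, for $0\le n\le N-1$, $$\frac{k_{n-1}}{k_n+k_{n-1}}\Phi_h^{n+\frac12}+\frac{k_n}{k_n+k_{n-1}}\Phi_h^{n-\frac12}=\mathcal{P}_h\big(|U_h^n|^2\big),$$ $$\bar\partial U_h^n-\mathrm{i}\,p_{n+\frac12}\Delta_hU_h^{n+\frac12}-\mathrm{i}\,q_{n+\frac12}\mathcal{P}_h\big(\Phi_h^{n+\frac12}U_h^{n+\frac12}\big)+r_{n+\frac12}U_h^{n+\frac12}=0 .$$ Put $\mathcal{M}_h^n=\|U_h^n\|^2$. Then for every $0\le n\le N-1$, $$\mathcal{M}_h^{n+1}=\mathcal{M}_h^n-2k_n\,r_{n+\frac12}\,\|U_h^{n+\frac12}\|^2 .$$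
   Context: The scheme discretizes $\mathrm{i}u_t+p(t)\Delta u+q(t)|u|^2u+\mathrm{i}r(t)u=0$ on $\Omega\times(0,T]$ with $u(\cdot,0)=u_0\in H^1_0(\Omega;\mathbb{C})$ and homogeneous Dirichlet boundary conditions, where $\Omega\subset\mathbb{R}^d$, $d\in\{1,2,3\}$, is bounded, convex, polygonal, $T>0$, and $p,q,r:[0,T]\to\mathbb{R}$ are smooth. Time grid: $0=t_0<t_1<\dots<t_N=T$, $k_n=t_{n+1}-t_n$, $t_{n+\frac12}=\frac{t_n+t_{n+1}}2$, and $f_{n+\frac12}=f(t_{n+\frac12})$ for $f=p,q,r$. For a sequence $(V^n)$: $\bar\partial V^n=\frac{V^{n+1}-V^n}{k_n}$. Moreover $U_h^{n+\frac12}=\frac{U_h^{n+1}+U_h^n}{2}$ for $0\le n\le N-1$, while the $\Phi_h^{n+\frac12}$ are independent unknowns. Finite elements: $\mathcal{T}_h$ is a (fixed in time) conforming shape-regular partition of $\Omega$ into simplices or $d$-dimensional cubes. $\mathcal{V}_h(\mathbb{R})$ is the space of real functions $\chi\in C(\bar\Omega)\cap H^1_0(\Omega)$ whose restriction to each element $K\in\mathcal{T}_h$ is a polynomial of total degree at most $\ell$ ($K$ a simplex) or of degree at most $\ell$ in each variable ($K$ a cube), with $\ell\ge1$ fixed; $\mathcal{V}_h(\mathbb{C})=\{\chi_R+\mathrm{i}\chi_I:\chi_R,\chi_I\in\mathcal{V}_h(\mathbb{R})\}$. The $L^2$-projection $\mathcal{P}_h:L^2(\Omega)\to\mathcal{V}_h(\mathbb{C})$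 and discrete Laplacian $-\Delta_h:H^1_0(\Omega)\to\mathcal{V}_h(\mathbb{C})$ are defined by $\int_\Omega(\mathcal{P}_hv)\chi\,dx=\int_\Omega v\chi\,dx$ and $\int_\Omega(-\Delta_hv)\chi\,dx=\int_\Omega\nabla v\cdot\nabla\chi\,dx$ for all $\chi\in\mathcal{V}_h(\mathbb{R})$. $\|\cdot\|$ is the $L^2(\Omega)$-norm. *)

theory Defs
  imports "HOL-Analysis.Analysis"
begin

section \<open>Sobolev spaces\<close>

text \<open>
  Functions on \<open>\<Omega>\<close> are represented by total functions on \<open>real^'d\<close>; Sobolev functions are arbitrary
  representatives, all integrals being taken with respect to Lebesgue measure on \<open>\<Omega>\<close>.
  The codomain \<open>'b\<close> is \<open>real\<close> or \<open>complex\<close> in all applications.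
\<close>

definition L2 :: "(real^'d) set \<Rightarrow> (real^'d \<Rightarrow> 'b::euclidean_space) set" where
  "L2 \<Omega> = {v \<in> borel_measurable (lebesgue_on \<Omega>). integrable (lebesgue_on \<Omega>) (\<lambda>x. (norm (v x))\<^sup>2)}"

definition L2norm :: "(real^'d) set \<Rightarrow> (real^'d \<Rightarrow> 'b::euclidean_space) \<Rightarrow> real" where
  "L2norm \<Omega> v = sqrt (LINT x|lebesgue_on \<Omega>. (norm (v x))\<^sup>2)"

definition partial :: "'d \<Rightarrow> (real^'d \<Rightarrow> 'b::real_normed_vector) \<Rightarrow> real^'d \<Rightarrow> 'b" where
  "partial i f x = frechet_derivative f (at x) (axis i 1)"

text \<open>
  \<open>C_infinity\<close> is the largest class of differentiable functions closed under partial derivatives: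
  all iterated partial derivatives exist and are differentiable, hence continuous.
\<close>

coinductive C_infinity :: "(real^'d \<Rightarrow> 'b::real_normed_vector) \<Rightarrow> bool" where
  "\<lbrakk>\<forall>x. f differentiable (at x); \<forall>i. C_infinity (partial i f)\<rbrakk> \<Longrightarrow> C_infinity f"

definition test_functions :: "(real^'d) set \<Rightarrow> (real^'d \<Rightarrow> 'b::real_normed_vector) set" where
  "test_functions \<Omega> =
     {\<phi>. C_infinity \<phi> \<and> compact (closure {x. \<phi> x \<noteq> 0}) \<and> closure {x. \<phi> x \<noteq> 0} \<subseteq> \<Omega>}"

definition has_weak_gradient ::
  "(real^'d) set \<Rightarrow> (real^'d \<Rightarrow> 'b::euclidean_space) \<Rightarrow> (real^'d \<Rightarrow> 'b^'d) \<Rightarrow> bool" where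
  "has_weak_gradient \<Omega> v g \<longleftrightarrow>
     (\<forall>i. (\<lambda>x. g x $ i) \<in> L2 \<Omega>) \<and>
     (\<forall>\<phi> \<in> test_functions \<Omega>. \<forall>i.
        (LINT x|lebesgue_on \<Omega>. partial i \<phi> x *\<^sub>R v x) = - (LINT x|lebesgue_on \<Omega>. \<phi> x *\<^sub>R (g x $ i)))"

definition weak_gradient ::
  "(real^'d) set \<Rightarrow> (real^'d \<Rightarrow> 'b::euclidean_space) \<Rightarrow> (real^'d \<Rightarrow> 'b^'d)" where
  "weak_gradient \<Omega> v = (SOME g. has_weak_gradient \<Omega> v g)"

text \<open>\<open>H10 \<Omega>\<close> is the closure of the test functions in \<open>H\<^sup>1(\<Omega>)\<close>.\<close>

definition H10 :: "(real^'d) set \<Rightarrow> (real^'d \<Rightarrow> 'b::euclidean_space) set" where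
  "H10 \<Omega> = {v \<in> L2 \<Omega>. \<exists>g. has_weak_gradient \<Omega> v g \<and>
     (\<exists>\<phi> :: nat \<Rightarrow> real^'d \<Rightarrow> 'b. (\<forall>m. \<phi> m \<in> test_functions \<Omega>) \<and>
        (\<lambda>m. L2norm \<Omega> (\<lambda>x. \<phi> m x - v x)) \<longlonglongrightarrow> 0 \<and>
        (\<forall>i. (\<lambda>m. L2norm \<Omega> (\<lambda>x. partial i (\<phi> m) x - g x $ i)) \<longlonglongrightarrow> 0))}"

section \<open>Meshes and finite element spaces\<close>

text \<open>
  Cubes have edges parallel to the coordinate axes, so that ``degree in each variable'' refers to
  the variables along the edges.
\<close>

definition is_cube :: "(real^'d) set \<Rightarrow> bool" where
  "is_cube K \<longleftrightarrow> (\<exists>a s. s > 0 \<and> K = cbox a (\<chi> i. a $ i + s))"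

definition is_simplex :: "(real^'d) set \<Rightarrow> bool" where
  "is_simplex K \<longleftrightarrow> int CARD('d) simplex K"

text \<open>
  Elements are closed and full-dimensional; since any two of them meet in a common (possibly empty)
  face, distinct elements have disjoint interiors.
\<close>

definition conforming_partition :: "(real^'d) set \<Rightarrow> (real^'d) set set \<Rightarrow> bool" where
  "conforming_partition \<Omega> \<T> \<longleftrightarrow>
     finite \<T> \<and> \<Union>\<T> = closure \<Omega> \<and>
     (\<forall>K\<in>\<T>. is_simplex K \<or> is_cube K) \<and>
     (\<forall>K\<in>\<T>. \<forall>K'\<in>\<T>. (K \<inter> K') face_of K \<and> (K \<inter> K') face_of K')"

text \<open>The ratio of the diameter of an element to that of an inscribed ball is at most \<open>\<sigma>\<close>.\<close>

definition shape_regular :: "real \<Rightarrow> (real^'d) set set \<Rightarrow> bool" where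
  "shape_regular \<sigma> \<T> \<longleftrightarrow>
     (\<forall>K\<in>\<T>. \<exists>x \<rho>. \<rho> > 0 \<and> cball x \<rho> \<subseteq> K \<and> diameter K \<le> \<sigma> * (2 * \<rho>))"

definition poly_total_on :: "nat \<Rightarrow> (real^'d) set \<Rightarrow> (real^'d \<Rightarrow> real) \<Rightarrow> bool" where
  "poly_total_on l K f \<longleftrightarrow> (\<exists>c :: ('d \<Rightarrow> nat) \<Rightarrow> real. \<forall>x\<in>K.
     f x = (\<Sum>\<alpha> | (\<Sum>i\<in>UNIV. \<alpha> i) \<le> l. c \<alpha> * (\<Prod>i\<in>UNIV. (x $ i) ^ \<alpha> i)))"

definition poly_each_on :: "nat \<Rightarrow> (real^'d) set \<Rightarrow> (real^'d \<Rightarrow> real) \<Rightarrow> bool" where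
  "poly_each_on l K f \<longleftrightarrow> (\<exists>c :: ('d \<Rightarrow> nat) \<Rightarrow> real. \<forall>x\<in>K.
     f x = (\<Sum>\<alpha> | \<forall>i. \<alpha> i \<le> l. c \<alpha> * (\<Prod>i\<in>UNIV. (x $ i) ^ \<alpha> i)))"

text \<open>
  Elements of the finite element space live on \<open>closure \<Omega>\<close>; extending them by zero to \<open>real^'d\<close>
  makes equality of functions coincide with equality on \<open>closure \<Omega>\<close>. (An interval is both a simplex
  and a cube, but in one variable the two polynomial conditions agree.)
\<close>

definition Vh_real :: "(real^'d) set \<Rightarrow> (real^'d) set set \<Rightarrow> nat \<Rightarrow> (real^'d \<Rightarrow> real) set" where
  "Vh_real \<Omega> \<T> l = {f. continuous_on (closure \<Omega>) f \<and> f \<in> H10 \<Omega> \<and>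
     (\<forall>K\<in>\<T>. (is_simplex K \<longrightarrow> poly_total_on l K f) \<and> (is_cube K \<longrightarrow> poly_each_on l K f)) \<and>
     (\<forall>x. x \<notin> closure \<Omega> \<longrightarrow> f x = 0)}"

definition Vh_complex :: "(real^'d) set \<Rightarrow> (real^'d) set set \<Rightarrow> nat \<Rightarrow> (real^'d \<Rightarrow> complex) set" where
  "Vh_complex \<Omega> \<T> l =
     {\<lambda>x. complex_of_real (f x) + \<i> * complex_of_real (g x) | f g.
        f \<in> Vh_real \<Omega> \<T> l \<and> g \<in> Vh_real \<Omega> \<T> l}"

section \<open>L2-projection and discrete Laplacian\<close>

definition Ph ::
  "(real^'d) set \<Rightarrow> (real^'d) set set \<Rightarrow> nat \<Rightarrow> (real^'d \<Rightarrow> complex) \<Rightarrow> (real^'d \<Rightarrow> complex)" where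
  "Ph \<Omega> \<T> l v = (THE w. w \<in> Vh_complex \<Omega> \<T> l \<and>
     (\<forall>f \<in> Vh_real \<Omega> \<T> l.
        (LINT x|lebesgue_on \<Omega>. w x * complex_of_real (f x)) =
        (LINT x|lebesgue_on \<Omega>. v x * complex_of_real (f x))))"

definition neg_Laplace_h ::
  "(real^'d) set \<Rightarrow> (real^'d) set set \<Rightarrow> nat \<Rightarrow> (real^'d \<Rightarrow> complex) \<Rightarrow> (real^'d \<Rightarrow> complex)" where
  "neg_Laplace_h \<Omega> \<T> l v = (THE w. w \<in> Vh_complex \<Omega> \<T> l \<and>
     (\<forall>f \<in> Vh_real \<Omega> \<T> l.
        (LINT x|lebesgue_on \<Omega>. w x * complex_of_real (f x)) =
        (LINT x|lebesgue_on \<Omega>. (\<Sum>i\<in>UNIV.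
           weak_gradient \<Omega> v x $ i * complex_of_real (weak_gradient \<Omega> f x $ i)))))"

definition Laplace_h ::
  "(real^'d) set \<Rightarrow> (real^'d) set set \<Rightarrow> nat \<Rightarrow> (real^'d \<Rightarrow> complex) \<Rightarrow> (real^'d \<Rightarrow> complex)" where
  "Laplace_h \<Omega> \<T> l v x = - neg_Laplace_h \<Omega> \<T> l v x"

section \<open>Coefficients, midpoints and mass\<close>

text \<open>Infinitely differentiable on \<open>[0, T]\<close>, with one-sided derivatives at the end points.\<close>

definition smooth_coefficient :: "real \<Rightarrow> (real \<Rightarrow> real) \<Rightarrow> bool" where
  "smooth_coefficient T f \<longleftrightarrow> (\<exists>D :: nat \<Rightarrow> real \<Rightarrow> real. D 0 = f \<and>
     (\<forall>j. \<forall>s\<in>{0..T}. (D j has_real_derivative D (Suc j) s) (at s within {0..T})))"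

definition tmid :: "(nat \<Rightarrow> real) \<Rightarrow> nat \<Rightarrow> real" where
  "tmid t n = (t n + t (Suc n)) / 2"

definition Umid :: "(nat \<Rightarrow> 'x \<Rightarrow> complex) \<Rightarrow> nat \<Rightarrow> 'x \<Rightarrow> complex" where
  "Umid U n x = (U (Suc n) x + U n x) / 2"

definition mass :: "(real^'d) set \<Rightarrow> (nat \<Rightarrow> real^'d \<Rightarrow> complex) \<Rightarrow> nat \<Rightarrow> real" where
  "mass \<Omega> U n = (L2norm \<Omega> (U n))\<^sup>2"

text \<open>
  The fully discrete relaxation scheme. The integer index \<open>n\<close> of \<open>\<Phi>\<close> stands for the half-integer
  \<open>n + 1/2\<close>, so that \<open>\<Phi>\<close> ranges over \<open>-1 \<le> n \<le> N - 1\<close>, as does the index of the step sizes \<open>k\<close>.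
\<close>

definition relaxation_scheme ::
  "(real^'d) set \<Rightarrow> (real^'d) set set \<Rightarrow> nat \<Rightarrow> (real \<Rightarrow> real) \<Rightarrow> (real \<Rightarrow> real) \<Rightarrow> (real \<Rightarrow> real) \<Rightarrow>
   (real^'d \<Rightarrow> complex) \<Rightarrow> nat \<Rightarrow> (nat \<Rightarrow> real) \<Rightarrow> (int \<Rightarrow> real) \<Rightarrow>
   (nat \<Rightarrow> real^'d \<Rightarrow> complex) \<Rightarrow> (int \<Rightarrow> real^'d \<Rightarrow> real) \<Rightarrow> bool" where
  "relaxation_scheme \<Omega> \<T> l p q r u0 N t k U \<Phi> \<longleftrightarrow>
     (\<forall>n\<le>N. U n \<in> Vh_complex \<Omega> \<T> l) \<and>
     (\<forall>n. - 1 \<le> n \<and> n \<le> int N - 1 \<longrightarrow> \<Phi> n \<in> Vh_real \<Omega> \<T> l) \<and>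
     U 0 = Ph \<Omega> \<T> l u0 \<and>
     (\<lambda>x. complex_of_real (\<Phi> (- 1) x)) = Ph \<Omega> \<T> l (\<lambda>x. complex_of_real ((cmod (u0 x))\<^sup>2)) \<and>
     (\<forall>n<N. \<forall>x.
        complex_of_real
          (k (int n - 1) / (k (int n) + k (int n - 1)) * \<Phi> (int n) x
           + k (int n) / (k (int n) + k (int n - 1)) * \<Phi> (int n - 1) x)
        = Ph \<Omega> \<T> l (\<lambda>y. complex_of_real ((cmod (U n y))\<^sup>2)) x) \<and>
     (\<forall>n<N. \<forall>x.
        (U (Suc n) x - U n x) / complex_of_real (k (int n))
        - \<i> * complex_of_real (p (tmid t n)) * Laplace_h \<Omega> \<T> l (Umid U n) x
        - \<i> * complex_of_real (q (tmid t n))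
            * Ph \<Omega> \<T> l (\<lambda>y. complex_of_real (\<Phi> (int n) y) * Umid U n y) x
        + complex_of_real (r (tmid t n)) * Umid U n x = 0)"

end

theory Submission
  imports Defs "HOL-Real_Asymp.Real_Asymp" "HOL-Computational_Algebra.Polynomial"
    "HOL-Library.Function_Algebras"
begin

text \<open>
  Multiply the scheme by the conjugate of \<open>v = Umid U n\<close>, integrate and take real parts. The difference
  quotient gives half the increment of the mass, since \<open>Re ((a - b) * cnj (a + b)) = \<bar>a\<bar>\<^sup>2 - \<bar>b\<bar>\<^sup>2\<close>;
  the Laplacian and the potential contribute nothing, since testing \<open>neg_Laplace_h v\<close> and
  \<open>Ph (\<Phi> v)\<close> with \<open>v\<close> yields the real numbers \<open>\<parallel>\<nabla>v\<parallel>\<^sup>2\<close> and \<open>\<integral> \<Phi> \<bar>v\<bar>\<^sup>2\<close>.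

  Behind this lies that \<open>Ph\<close> and \<open>neg_Laplace_h\<close>, defined by \<open>THE\<close>, satisfy their defining equations.
  For this the finite element space must be a finite-dimensional inner product space. For the
  Laplacian, moreover, \<open>f \<mapsto> weak_gradient f\<close> must be linear almost everywhere although it is an arbitrary
  choice, which is the uniqueness of weak gradients: the fundamental lemma of the calculus of
  variations, with test functions built from \<open>exp (- c / x)\<close>.
\<close>

section \<open>Smooth bump functions\<close>

text \<open>The polynomial factor makes the family closed under differentiation.\<close>

definition flat :: "real \<Rightarrow> real poly \<Rightarrow> real \<Rightarrow> real" where
  "flat c P x = (if x > 0 then poly P (1 / x) * exp (- c / x) else 0)"

lemma poly_mult_exp_tendsto_0:
  fixes P :: "real poly"
  assumes "c > 0"
  shows "((\<lambda>y. poly P y * exp (- c * y)) \<longlongrightarrow> 0) at_top"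
proof -
  have "((\<lambda>y. y ^ i * exp (- c * y)) \<longlongrightarrow> 0) at_top" for i
    using assms by real_asymp
  then have "((\<lambda>y. \<Sum>i\<le>degree P. coeff P i * (y ^ i * exp (- c * y))) \<longlongrightarrow> (\<Sum>i\<le>degree P. coeff P i * 0)) at_top"
    by (intro tendsto_intros)
  then show ?thesis
    by (simp add: poly_altdef sum_distrib_right mult.assoc)
qed

text \<open>From the right, the substitution y = 1/x turns the claim into decay of a polynomial
  times \<open>exp (- c * y)\<close> at infinity; from the left the function is constantly
  0.\<close>

lemma flat_tendsto_0:
  assumes "c > 0"
  shows "(flat c P \<longlongrightarrow> 0) (at 0)"
proof (rule filterlim_split_at)
  have "eventually (\<lambda>x. x < (0::real)) (at_left 0)"
    by (simp add: eventually_at_filter)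
  then show "(flat c P \<longlongrightarrow> 0) (at_left 0)"
    by (intro tendsto_eventually) (auto elim!: eventually_mono simp: flat_def)
  have "((\<lambda>x. poly P (inverse x) * exp (- c * inverse x)) \<longlongrightarrow> 0) (at_right 0)"
    by (rule filterlim_compose[OF poly_mult_exp_tendsto_0[OF assms] filterlim_inverse_at_top_right])
  moreover have "eventually (\<lambda>x. poly P (inverse x) * exp (- c * inverse x) = flat c P x) (at_right 0)"
    by (auto simp: eventually_at_filter flat_def divide_inverse)
  ultimately show "(flat c P \<longlongrightarrow> 0) (at_right 0)"
    by (rule Lim_transform_eventually)
qed

text \<open>With y = 1/x one has dy/dx = - y^2, so for x > 0 the chain rule gives y^2 (c P(y) -
  P'(y)) exp(- c y); \<open>[:0, 0, 1:]\<close> is the polynomial y^2.\<close>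

lemma flat_has_real_derivative:
  assumes "c > 0"
  shows "(flat c P has_real_derivative flat c ([:0, 0, 1:] * (smult c P - pderiv P)) x) (at x)"
proof (cases "x = 0")
  case True
  have "(flat c ([:0, 1:] * P) \<longlongrightarrow> 0) (at 0)"
    by (rule flat_tendsto_0[OF assms])
  \<comment> \<open>Dividing by \<open>h\<close> multiplies the polynomial by its variable 1/h, so
    the difference quotient at 0 again belongs to the family and tends to 0.\<close>
  moreover have "flat c ([:0, 1:] * P) = (\<lambda>h. (flat c P (0 + h) - flat c P 0) / h)"
    by (auto simp: flat_def fun_eq_iff)
  ultimately show ?thesis
    using True by (simp add: DERIV_def) (simp add: flat_def)
next
  case False
  then consider "x > 0" | "x < 0" by linarith
  then show ?thesis
  proof cases
    case 1
    have "((\<lambda>x. poly P (1 / x) * exp (- c / x)) has_real_derivative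
        flat c ([:0, 0, 1:] * (smult c P - pderiv P)) x) (at x)"
      using 1 by (auto intro!: derivative_eq_intros DERIV_chain2[OF poly_DERIV]
        simp: flat_def field_simps power2_eq_square)
    moreover have "eventually (\<lambda>y. poly P (1 / y) * exp (- c / y) = flat c P y) (nhds x)"
      using 1 by (auto simp: flat_def elim!: eventually_mono[OF order_tendstoD(1)[OF filterlim_ident]])
    ultimately show ?thesis
      using DERIV_cong_ev[of x x "\<lambda>y. poly P (1 / y) * exp (- c / y)" "flat c P"] by simp
  next
    case 2
    have "eventually (\<lambda>y. 0 = flat c P y) (nhds x)"
      using 2 by (auto simp: flat_def elim!: eventually_mono[OF order_tendstoD(2)[OF filterlim_ident]])
    then have "(flat c P has_real_derivative 0) (at x)"
      using DERIV_const by (rule DERIV_cong_ev[OF refl _ refl, THEN iffD1])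
    moreover have "flat c Q x = 0" for Q
      using 2 by (simp add: flat_def)
    ultimately show ?thesis by (simp only:)
  qed
qed

lemma flat_nonneg: "flat c 1 x \<ge> 0"
  and flat_le_1: "c > 0 \<Longrightarrow> flat c 1 x \<le> 1"
  by (auto simp: flat_def divide_nonneg_pos)

section \<open>Closure properties of smooth functions of several variables\<close>

lemma C_infinityD:
  assumes "C_infinity f"
  shows "f differentiable (at x)" "C_infinity (partial i f)"
  using assms by (auto elim: C_infinity.cases)

lemma C_infinity_continuous_on:
  assumes "C_infinity f"
  shows "continuous_on A f"
  using C_infinityD(1)[OF assms] differentiable_imp_continuous_within
  by (meson continuous_at_imp_continuous_on)

lemma partial_eqI:
  assumes "(f has_derivative D) (at x)"
  shows "partial i f x = D (axis i 1)"
  unfolding partial_def using frechet_derivative_at[OF assms] by simp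

text \<open>By the product rule this class is closed under partial derivatives, which makes it the
  invariant of the coinduction for products.\<close>

inductive leibniz_closure :: "(real^'d \<Rightarrow> real) \<Rightarrow> bool" where
  mult: "C_infinity f \<Longrightarrow> C_infinity g \<Longrightarrow> leibniz_closure (\<lambda>x. f x * g x)"
| add: "leibniz_closure f \<Longrightarrow> leibniz_closure g \<Longrightarrow> leibniz_closure (\<lambda>x. f x + g x)"

lemma leibniz_closure_partial:
  assumes "leibniz_closure f"
  shows "(\<forall>x. f differentiable (at x)) \<and> (\<forall>i. leibniz_closure (partial i f))"
  using assms
proof induction
  case (mult f g)
  have d: "((\<lambda>x. f x * g x) has_derivative (\<lambda>h. f x * frechet_derivative g (at x) h + frechet_derivative f (at x) h * g x)) (at x)" for x
    using C_infinityD(1)[OF mult(1)] C_infinityD(1)[OF mult(2)]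
    by (intro has_derivative_mult) (simp_all add: frechet_derivative_works[symmetric])
  then have "partial i (\<lambda>x. f x * g x) = (\<lambda>x. f x * partial i g x + partial i f x * g x)" for i
    using partial_eqI[OF d] by (auto simp: fun_eq_iff partial_def)
  then show ?case
    using d mult C_infinityD(2) by (auto simp: differentiable_def intro!: leibniz_closure.intros)
next
  case (add f g)
  have d: "((\<lambda>x. f x + g x) has_derivative (\<lambda>h. frechet_derivative f (at x) h + frechet_derivative g (at x) h)) (at x)" for x
    using add.IH by (intro has_derivative_add) (simp_all add: frechet_derivative_works[symmetric])
  then have "partial i (\<lambda>x. f x + g x) = (\<lambda>x. partial i f x + partial i g x)" for i
    using partial_eqI[OF d] by (auto simp: fun_eq_iff partial_def)
  then show ?case
    using d add.IH by (auto simp: differentiable_def intro!: leibniz_closure.intros)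
qed

lemma C_infinity_const: "C_infinity (\<lambda>x::real^'d. c::real)"
proof -
  \<comment> \<open>The coinduction invariant ranges over all constants, because the partial
    derivatives are the constant 0 rather than \<open>c\<close>.\<close>
  have "C_infinity f" if "\<exists>c. f = (\<lambda>x::real^'d. c::real)" for f
    using that
  proof (coinduction arbitrary: f rule: C_infinity.coinduct)
    case C_infinity
    then obtain c where f: "f = (\<lambda>x. c)" by blast
    have "partial i f = (\<lambda>x. 0)" for i
      using partial_eqI[OF has_derivative_const] by (auto simp: f)
    then show ?case by (auto simp: f)
  qed
  then show ?thesis by blast
qed

lemma C_infinity_if_leibniz_closure: "leibniz_closure h \<Longrightarrow> C_infinity h"
  by (coinduction arbitrary: h rule: C_infinity.coinduct) (auto dest: leibniz_closure_partial)

lemma C_infinity_mult: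
  fixes f g :: "real^'d \<Rightarrow> real"
  assumes "C_infinity f" "C_infinity g"
  shows "C_infinity (\<lambda>x. f x * g x)"
  by (rule C_infinity_if_leibniz_closure[OF leibniz_closure.mult[OF assms]])

lemma C_infinity_prod:
  fixes f :: "'i \<Rightarrow> real^'d \<Rightarrow> real"
  assumes "\<And>i. i \<in> I \<Longrightarrow> C_infinity (f i)"
  shows "C_infinity (\<lambda>x. \<Prod>i\<in>I. f i x)"
  using assms by (induction I rule: infinite_finite_induct) (auto intro: C_infinity_mult C_infinity_const)

text \<open>By the chain rule the partial derivative in direction \<open>j\<close> is
  \<open>s * axis j 1 $ i\<close> times a member of the family. That constant is absorbed into the
  polynomial, so the functions with arbitrary \<open>P\<close> and fixed \<open>c\<close>,
  \<open>s\<close>, \<open>a\<close>, \<open>i\<close> form the coinduction invariant.\<close>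

lemma C_infinity_flat:
  assumes "c > 0"
  shows "C_infinity (\<lambda>x::real^'d. flat c P (s * x $ i + a))"
proof -
  have "C_infinity f" if "\<exists>P. f = (\<lambda>x::real^'d. flat c P (s * x $ i + a))" for f
    using that
  proof (coinduction arbitrary: f rule: C_infinity.coinduct)
    case C_infinity
    then obtain P where f: "f = (\<lambda>x. flat c P (s * x $ i + a))" by blast
    define Q where "Q = [:0, 0, 1:] * (smult c P - pderiv P)"
    have d: "(f has_derivative (\<lambda>h. flat c Q (s * x $ i + a) * (s * h $ i))) (at x)" for x
    proof -
      have "((\<lambda>x::real^'d. s * x $ i + a) has_derivative (\<lambda>h. s * h $ i)) (at x)"
        using has_derivative_add[OF has_derivative_mult_right
          [OF bounded_linear_imp_has_derivative[OF bounded_linear_vec_nth[of i]], of s] has_derivative_const[of a]]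
        by simp
      then show ?thesis
        unfolding f Q_def
        by (rule has_derivative_compose[OF _ flat_has_real_derivative[OF assms, unfolded has_field_derivative_def]])
    qed
    have "partial j f = (\<lambda>x. flat c (smult (s * axis j 1 $ i) Q) (s * x $ i + a))" for j
      using partial_eqI[OF d] by (auto simp: fun_eq_iff flat_def)
    then show ?case using d by (auto simp: differentiable_def)
  qed
  then show ?thesis by blast
qed

text \<open>\<open>c \<rightarrow> 0\<close> makes these test functions increase to the indicator function of the box.\<close>

definition box_bump :: "real^'d \<Rightarrow> real^'d \<Rightarrow> real \<Rightarrow> real^'d \<Rightarrow> real" where
  "box_bump a b c x = (\<Prod>i\<in>UNIV. flat c 1 (x $ i - a $ i) * flat c 1 (b $ i - x $ i))"

lemma box_bump_eq_0: "x \<notin> box a b \<Longrightarrow> box_bump a b c x = 0"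
  by (fastforce simp: box_bump_def mem_box_cart flat_def)

lemma box_bump_nonneg: "0 \<le> box_bump a b c x"
  unfolding box_bump_def by (intro prod_nonneg) (simp add: flat_nonneg)

lemma box_bump_le_1: "c > 0 \<Longrightarrow> box_bump a b c x \<le> 1"
  unfolding box_bump_def by (intro prod_le_1) (auto simp: flat_nonneg flat_le_1 intro!: mult_le_one)

lemma box_bump_in_test_functions:
  fixes a b :: "real^'d"
  assumes "c > 0" "cbox a b \<subseteq> \<Omega>"
  shows "box_bump a b c \<in> test_functions \<Omega>"
proof -
  \<comment> \<open>Both factors are written with an affine argument \<open>s * x $ i + a\<close>,
    where \<open>s\<close> is 1 or -1, to which smoothness of \<open>flat\<close> applies.\<close>
  have "C_infinity (\<lambda>x::real^'d. flat c 1 (1 * x $ i + (- a $ i)) * flat c 1 ((-1) * x $ i + b $ i))" for i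
    by (intro C_infinity_mult C_infinity_flat assms)
  then have "C_infinity (box_bump a b c)"
    unfolding box_bump_def [abs_def] by (intro C_infinity_prod) (simp add: algebra_simps)
  moreover have sub: "closure {x. box_bump a b c x \<noteq> 0} \<subseteq> cbox a b"
    using box_bump_eq_0[of _ a b c] box_subset_cbox[of a b] by (intro closure_minimal) auto
  moreover have "compact (closure {x. box_bump a b c x \<noteq> 0})"
    using bounded_subset[OF bounded_cbox sub] by (simp add: compact_eq_bounded_closed)
  ultimately show ?thesis
    using assms by (auto simp: test_functions_def)
qed

lemma box_bump_tendsto:
  "(\<lambda>n. box_bump a b (1 / real (Suc n)) x) \<longlonglongrightarrow> indicator (box a b) x"
proof (cases "x \<in> box a b")
  case True
  have "(\<lambda>n. flat (1 / real (Suc n)) 1 y) \<longlonglongrightarrow> 1" if "y > 0" for y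
    using that by (simp add: flat_def) real_asymp
  then have "(\<lambda>n. box_bump a b (1 / real (Suc n)) x) \<longlonglongrightarrow> (\<Prod>i\<in>(UNIV::'a set). 1 * 1)"
    using True unfolding box_bump_def mem_box_cart by (intro tendsto_prod tendsto_mult) auto
  then show ?thesis using True by simp
qed (simp add: box_bump_eq_0)

section \<open>Uniqueness and linearity of weak gradients\<close>

lemma L2_bound:
  assumes f: "f \<in> L2 \<Omega>" and h: "h \<in> borel_measurable (lebesgue_on \<Omega>)"
    and le: "\<And>x. norm (h x) \<le> C * norm (f x)"
  shows "h \<in> L2 \<Omega>"
proof -
  have "integrable (lebesgue_on \<Omega>) (\<lambda>x. (norm (h x))\<^sup>2)"
  proof (rule Bochner_Integration.integrable_bound)
    show "integrable (lebesgue_on \<Omega>) (\<lambda>x. C\<^sup>2 * (norm (f x))\<^sup>2)"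
      using f by (simp add: L2_def)
    show "AE x in lebesgue_on \<Omega>. norm ((norm (h x))\<^sup>2) \<le> norm (C\<^sup>2 * (norm (f x))\<^sup>2)"
      using power_mono[OF le norm_ge_zero, of _ 2] by (simp add: power_mult_distrib)
  qed (use h in measurable)
  with h show ?thesis by (simp add: L2_def)
qed

lemma L2_add:
  assumes f: "f \<in> L2 \<Omega>" and g: "g \<in> L2 \<Omega>"
  shows "(\<lambda>x. f x + g x) \<in> L2 \<Omega>"
proof -
  have [measurable]: "f \<in> borel_measurable (lebesgue_on \<Omega>)" "g \<in> borel_measurable (lebesgue_on \<Omega>)"
    using f g by (auto simp: L2_def)
  have "(norm (f x + g x))\<^sup>2 \<le> 2 * (norm (f x))\<^sup>2 + 2 * (norm (g x))\<^sup>2" for x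
    using power_mono[OF norm_triangle_ineq[of "f x" "g x"] norm_ge_zero, of 2]
      sum_squares_bound[of "norm (f x)" "norm (g x)"] by (simp add: power2_sum)
  then have "AE x in lebesgue_on \<Omega>. norm ((norm (f x + g x))\<^sup>2) \<le> norm (2 * (norm (f x))\<^sup>2 + 2 * (norm (g x))\<^sup>2)"
    by simp
  moreover have "integrable (lebesgue_on \<Omega>) (\<lambda>x. 2 * (norm (f x))\<^sup>2 + 2 * (norm (g x))\<^sup>2)"
    using f g by (simp add: L2_def)
  moreover have "(\<lambda>x. (norm (f x + g x))\<^sup>2) \<in> borel_measurable (lebesgue_on \<Omega>)"
    by measurable
  ultimately have "integrable (lebesgue_on \<Omega>) (\<lambda>x. (norm (f x + g x))\<^sup>2)"
    using Bochner_Integration.integrable_bound by blast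
  then show ?thesis by (simp add: L2_def)
qed

lemma L2_scaleR:
  assumes "f \<in> L2 \<Omega>"
  shows "(\<lambda>x. c *\<^sub>R f x) \<in> L2 \<Omega>"
  using assms by (intro L2_bound[OF assms, of _ "\<bar>c\<bar>"]) (auto simp: L2_def)

lemma L2_complex_combination:
  fixes f g :: "real^'d \<Rightarrow> real"
  assumes f: "f \<in> L2 \<Omega>" and g: "g \<in> L2 \<Omega>"
  shows "(\<lambda>x. complex_of_real (f x) + \<i> * complex_of_real (g x)) \<in> L2 \<Omega>"
  using f g by (intro L2_add L2_bound[OF f, of _ 1] L2_bound[OF g, of _ 1])
    (auto simp: L2_def norm_mult)

text \<open>The bound |f| |g| <= |f|^2 + |g|^2 gives an integrable majorant. Keeping the product as
  a separate function \<open>h\<close> lets one argument serve scalar multiples, products in an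
  algebra and products with a conjugate.\<close>

lemma L2_integrable_product:
  fixes h :: "real^'d \<Rightarrow> 'c::{banach, second_countable_topology}"
  assumes f: "f \<in> L2 \<Omega>" and g: "g \<in> L2 \<Omega>" and h: "h \<in> borel_measurable (lebesgue_on \<Omega>)"
    and le: "\<And>x. norm (h x) \<le> norm (f x) * norm (g x)"
  shows "integrable (lebesgue_on \<Omega>) h"
proof (rule Bochner_Integration.integrable_bound)
  show "integrable (lebesgue_on \<Omega>) (\<lambda>x. (norm (f x))\<^sup>2 + (norm (g x))\<^sup>2)"
    using f g by (auto simp: L2_def)
  have "norm (h x) \<le> (norm (f x))\<^sup>2 + (norm (g x))\<^sup>2" for x
    using le[of x] sum_squares_bound[of "norm (f x)" "norm (g x)"]
      mult_nonneg_nonneg[OF norm_ge_zero norm_ge_zero, of "f x" "g x"] by linarith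
  then show "AE x in lebesgue_on \<Omega>. norm (h x) \<le> norm ((norm (f x))\<^sup>2 + (norm (g x))\<^sup>2)"
    by simp
qed (rule h)

lemma L2_integrable_scaleR:
  assumes f: "f \<in> L2 \<Omega>" and g: "g \<in> L2 \<Omega>"
  shows "integrable (lebesgue_on \<Omega>) (\<lambda>x. f x *\<^sub>R g x)"
  using f g by (intro L2_integrable_product[OF f g]) (auto simp: L2_def)

lemma L2_integrable_mult:
  fixes f g :: "real^'d \<Rightarrow> 'b::{euclidean_space, real_normed_algebra}"
  assumes f: "f \<in> L2 \<Omega>" and g: "g \<in> L2 \<Omega>"
  shows "integrable (lebesgue_on \<Omega>) (\<lambda>x. f x * g x)"
  using f g by (intro L2_integrable_product[OF f g]) (auto simp: L2_def norm_mult_ineq)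

lemma L2_integrable_mult_of_real:
  fixes f :: "real^'d \<Rightarrow> complex" and g :: "real^'d \<Rightarrow> real"
  assumes f: "f \<in> L2 \<Omega>" and g: "g \<in> L2 \<Omega>"
  shows "integrable (lebesgue_on \<Omega>) (\<lambda>x. f x * complex_of_real (g x))"
  using f g by (intro L2_integrable_product[OF f g]) (auto simp: L2_def norm_mult)

text \<open>The closure is compact, so the function is bounded there, and a bounded open set has
  finite measure.\<close>

lemma continuous_on_closure_in_L2:
  fixes f :: "real^'d \<Rightarrow> 'b::euclidean_space"
  assumes "open \<Omega>" "bounded \<Omega>" and f: "continuous_on (closure \<Omega>) f"
  shows "f \<in> L2 \<Omega>"
proof -
  have lm: "\<Omega> \<in> lmeasurable"
    using assms by (intro bounded_set_imp_lmeasurable) (auto intro: borel_open)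
  have meas: "f \<in> borel_measurable (lebesgue_on \<Omega>)"
    using continuous_on_subset[OF f closure_subset] lm
    by (intro continuous_imp_measurable_on_sets_lebesgue) auto
  have "bounded (f ` closure \<Omega>)"
    using assms by (intro compact_imp_bounded compact_continuous_image) (auto simp: compact_closure)
  then obtain B where B: "\<And>x. x \<in> closure \<Omega> \<Longrightarrow> norm (f x) \<le> B"
    by (auto simp: bounded_iff)
  have "integrable (lebesgue_on \<Omega>) (\<lambda>x. (norm (f x))\<^sup>2)"
  proof (rule Bochner_Integration.integrable_bound)
    show "integrable (lebesgue_on \<Omega>) (\<lambda>x. B\<^sup>2)"
      using lm by (intro finite_measure.integrable_const finite_measure_lebesgue_on)
    show "AE x in lebesgue_on \<Omega>. norm ((norm (f x))\<^sup>2) \<le> norm (B\<^sup>2)"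
      using B closure_subset[of \<Omega>] lm
      by (intro AE_I2) (auto simp: space_restrict_space intro!: power_mono)
  qed (use meas in measurable)
  with meas show ?thesis by (simp add: L2_def)
qed

section \<open>The fundamental lemma of the calculus of variations\<close>

text \<open>Dynkin's argument: the measurable sets over which \<open>f\<close> integrates to 0 are
  closed under complements and countable disjoint unions. Closure under complements is where the
  vanishing of the integral over the whole space enters.\<close>

lemma AE_zero_if_integrals_zero_on_generator:
  fixes f :: "'a \<Rightarrow> real"
  assumes M: "sigma_finite_measure M" and f: "integrable M f"
    and E: "Int_stable E" "sets M = sigma_sets (space M) E"
    and zero: "\<And>A. A \<in> E \<Longrightarrow> (LINT x:A|M. f x) = 0" "(LINT x|M. f x) = 0"
  shows "AE x in M. f x = 0"
proof (rule sigma_finite_measure.density_zero[OF M f])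
  fix A assume A: "A \<in> sets M"
  have int: "set_integrable M B f" if "B \<in> sets M" for B
    using f that unfolding set_integrable_def by (rule integrable_mult_indicator[rotated])
  have EP: "E \<subseteq> Pow (space M)"
    using E(2) sets.sets_into_space by (metis PowI sigma_sets.Basic subsetI)
  show "(LINT x:A|M. f x) = 0"
    using E(1) EP A[unfolded E(2)]
  proof (induction rule: sigma_sets_induct_disjoint)
    case (basic A) then show ?case by (rule zero)
  next
    case empty then show ?case by (simp add: set_lebesgue_integral_def)
  next
    case (compl A)
    then have A: "A \<in> sets M" by (simp add: E(2))
    have "(LINT x:space M|M. f x) = (LINT x:A \<union> (space M - A)|M. f x)"
      using sets.sets_into_space[OF A] by (simp add: Un_absorb1)
    also have "\<dots> = (LINT x:A|M. f x) + (LINT x:space M - A|M. f x)"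
      using A int by (intro set_integral_Un) auto
    finally show ?case using compl zero(2) f by (simp add: set_integral_space)
  next
    case (union A)
    then have A: "\<And>i. A i \<in> sets M" by (auto simp: E(2))
    have "(LINT x:(\<Union>i. A i)|M. f x) = (\<Sum>i. LINT x:A i|M. f x)"
      using union(1) A int by (intro lebesgue_integral_countable_add) (auto simp: disjoint_family_on_def)
    then show ?case using union by simp
  qed
qed

lemma Int_stable_box: "Int_stable (range (\<lambda>(a, b). box a b :: 'a::euclidean_space set))"
  by (auto simp: Int_stable_def box_Int_box)

text \<open>Letting the bump functions increase to the indicator of a box makes the integral of
  \<open>h\<close> over every box inside \<Omega> vanish. As boxes generate the Borel sets,
  \<open>h\<close> is zero almost everywhere in each such box, and countably many of them cover
  \<Omega>.\<close>

lemma fundamental_lemma_of_calculus_of_variations: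
  fixes h :: "real^'d \<Rightarrow> real"
  assumes \<Omega>: "open \<Omega>" "bounded \<Omega>" and h: "h \<in> L2 \<Omega>"
    and zero: "\<And>\<phi>. \<phi> \<in> test_functions \<Omega> \<Longrightarrow> (LINT x|lebesgue_on \<Omega>. \<phi> x * h x) = 0"
  shows "AE x in lebesgue_on \<Omega>. h x = 0"
proof -
  have lm: "\<Omega> \<in> sets lebesgue" using \<Omega> by auto
  have meas: "h \<in> borel_measurable (lebesgue_on \<Omega>)" using h by (simp add: L2_def)
  \<comment> \<open>Since \<Omega> is bounded, multiplying by the constant 1 shows that a
    square-integrable function is integrable.\<close>
  have "(\<lambda>x. 1::real) \<in> L2 \<Omega>" using \<Omega> by (intro continuous_on_closure_in_L2) auto
  from L2_integrable_mult[OF this h] have int: "integrable (lebesgue_on \<Omega>) h" by simp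
  have box0: "(LINT x|lebesgue_on \<Omega>. indicator (box a b) x * h x) = 0" if "cbox a b \<subseteq> \<Omega>" for a b
  proof -
    have "(\<lambda>n. LINT x|lebesgue_on \<Omega>. box_bump a b (1 / real (Suc n)) x * h x)
        \<longlonglongrightarrow> (LINT x|lebesgue_on \<Omega>. indicator (box a b) x * h x)"
    proof (rule integral_dominated_convergence)
      \<comment> \<open>The bump functions take values in [0, 1], so the absolute value of
        \<open>h\<close> dominates.\<close>
      show "integrable (lebesgue_on \<Omega>) (\<lambda>x. \<bar>h x\<bar>)" using int by simp
      show "AE x in lebesgue_on \<Omega>. (\<lambda>n. box_bump a b (1 / real (Suc n)) x * h x)
          \<longlonglongrightarrow> indicator (box a b) x * h x"
        by (intro AE_I2 tendsto_mult box_bump_tendsto tendsto_const)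
      show "(\<lambda>x. indicator (box a b) x * h x) \<in> borel_measurable (lebesgue_on \<Omega>)"
        by (intro borel_measurable_times meas measurable_restrict_space1 borel_measurable_indicator) simp
      fix n
      have "continuous_on \<Omega> (box_bump a b (1 / real (Suc n)))"
        using box_bump_in_test_functions[OF _ that, of "1 / real (Suc n)"]
        by (auto simp: test_functions_def intro: C_infinity_continuous_on)
      then show "(\<lambda>x. box_bump a b (1 / real (Suc n)) x * h x) \<in> borel_measurable (lebesgue_on \<Omega>)"
        using lm by (intro borel_measurable_times meas continuous_imp_measurable_on_sets_lebesgue) auto
      show "AE x in lebesgue_on \<Omega>. norm (box_bump a b (1 / real (Suc n)) x * h x) \<le> \<bar>h x\<bar>"
        using box_bump_nonneg[of a b "1 / real (Suc n)"] box_bump_le_1[of "1 / real (Suc n)" a b]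
        by (intro AE_I2) (simp add: abs_mult mult_left_le_one_le)
    qed
    moreover have "(LINT x|lebesgue_on \<Omega>. box_bump a b (1 / real (Suc n)) x * h x) = 0" for n
      by (rule zero, rule box_bump_in_test_functions[OF _ that]) simp
    ultimately have "(\<lambda>n. 0) \<longlonglongrightarrow> (LINT x|lebesgue_on \<Omega>. indicator (box a b) x * h x)"
      by (simp only:)
    then show ?thesis by (rule LIMSEQ_unique[OF _ tendsto_const])
  qed
  \<comment> \<open>Boxes generate the Borel sets, not the Lebesgue sets. The extension of
    \<open>h\<close> by zero is therefore replaced by a Borel function \<open>h'\<close> that agrees
    with it almost everywhere.\<close>
  define H where "H x = indicator \<Omega> x * h x" for x
  have H: "integrable lebesgue H"
    using int lm unfolding H_def by (simp add: integrable_restrict_space)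
  obtain h' where h': "h' \<in> borel_measurable lborel" "AE x in lborel. H x = h' x"
    using completion_ex_borel_measurable_real[OF borel_measurable_integrable[OF H]] by blast
  have h'c: "AE x in lebesgue. H x = h' x" by (rule AE_completion[OF h'(2)])
  have h'L: "h' \<in> borel_measurable lebesgue" using h'(1) by (rule measurable_completion)
  have "integrable lebesgue h'"
    using integrable_cong_AE_imp[OF H h'L] h'c by simp
  then have intH': "integrable lborel h'" using integrable_completion[OF h'(1)] by blast
  have eq: "(LINT x|lborel. indicator (box a b) x * h' x) = 0" if "cbox a b \<subseteq> \<Omega>" for a b
  proof -
    have "(\<lambda>x. indicator (box a b) x :: real) \<in> borel_measurable lborel" by simp
    then have ind: "(\<lambda>x. indicator (box a b) x * h' x) \<in> borel_measurable lborel"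
      using h'(1) by (rule borel_measurable_times)
    have ind2: "(\<lambda>x. indicator (box a b) x * H x) \<in> borel_measurable lebesgue"
      using H by (intro borel_measurable_times borel_measurable_indicator) auto
    have "(LINT x|lborel. indicator (box a b) x * h' x) = (LINT x|lebesgue. indicator (box a b) x * h' x)"
      by (rule integral_completion[OF ind, symmetric])
    also have "\<dots> = (LINT x|lebesgue. indicator (box a b) x * H x)"
      using h'c by (intro integral_cong_AE measurable_completion[OF ind] ind2) (auto elim!: eventually_mono)
    also have "\<dots> = (LINT x|lebesgue. indicator \<Omega> x *\<^sub>R (indicator (box a b) x * h x))"
      by (intro Bochner_Integration.integral_cong) (auto simp: H_def)
    also have "\<dots> = (LINT x|lebesgue_on \<Omega>. indicator (box a b) x * h x)"
      using lm by (simp add: integral_restrict_space)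
    finally show ?thesis using box0[OF that] by simp
  qed
  \<comment> \<open>Nothing is known about boxes that leave \<Omega>. Multiplying \<open>h'\<close>
    by the indicator of a fixed inner box repairs this: the intersection of that box with any other
    is again a box inside \<Omega>.\<close>
  have loc: "AE x in lborel. x \<in> box a b \<longrightarrow> h' x = 0" if ab: "cbox a b \<subseteq> \<Omega>" for a b
  proof -
    have "AE x in lborel. indicator (box a b) x * h' x = 0"
    proof (rule AE_zero_if_integrals_zero_on_generator)
      show "sigma_finite_measure (lborel :: (real^'d) measure)" by (rule sigma_finite_lborel)
      show "integrable lborel (\<lambda>x. indicator (box a b) x * h' x)"
        using integrable_mult_indicator[OF _ intH', of "box a b"] by simp
      show "Int_stable (range (\<lambda>(a, b). box a b :: (real^'d) set))" by (rule Int_stable_box)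
      show "sets lborel = sigma_sets (space lborel) (range (\<lambda>(a, b). box a b :: (real^'d) set))"
        by (simp add: borel_eq_box sets_measure_of)
      show "(LINT x:A|lborel. indicator (box a b) x * h' x) = 0"
        if "A \<in> range (\<lambda>(a, b). box a b)" for A
      proof -
        obtain c d where cd: "A \<inter> box a b = box c d"
          using \<open>A \<in> _\<close> by (auto simp: box_Int_box)
        \<comment> \<open>A nonempty open box has the closed box as its closure, which stays inside
          \<open>cbox a b\<close>; for an empty open box the closed one is uncontrolled, but the
          integral is 0 anyway.\<close>
        have "cbox c d \<subseteq> \<Omega> \<or> box c d = {}"
          using ab cd by (metis box_subset_cbox closure_box closure_minimal closed_cbox inf.cobounded2 order_trans)
        moreover have "(LINT x:A|lborel. indicator (box a b) x * h' x)
            = (LINT x|lborel. indicator (box c d) x * h' x)"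
          unfolding set_lebesgue_integral_def cd[symmetric]
          by (intro Bochner_Integration.integral_cong) (auto simp: indicator_def)
        ultimately show ?thesis using eq by auto
      qed
      show "(LINT x|lborel. indicator (box a b) x * h' x) = 0" by (rule eq[OF ab])
    qed
    then show ?thesis by (auto elim!: eventually_mono)
  qed
  obtain D where D: "countable D" "D \<subseteq> Pow \<Omega>" "\<And>X. X \<in> D \<Longrightarrow> \<exists>a b. X = cbox a b" "\<Union>D = \<Omega>"
    using open_countable_Union_open_cbox[OF \<Omega>(1)] by metis
  \<comment> \<open>The countable cover consists of closed boxes, whose boundaries are null
    sets.\<close>
  have cloc: "AE x in lborel. x \<in> cbox a b \<longrightarrow> h' x = 0" if "cbox a b \<subseteq> \<Omega>" for a b
  proof -
    have "cbox a b - box a b \<in> null_sets lborel"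
      using negligible_frontier_interval[of a b]
      by (simp add: negligible_iff_null_sets null_sets_completion_iff)
    from AE_not_in[OF this] loc[OF that] show ?thesis
      by eventually_elim auto
  qed
  have "AE x in lborel. \<forall>X\<in>D. x \<in> X \<longrightarrow> h' x = 0"
  proof (rule AE_ball_countable'[OF _ D(1)])
    fix X assume "X \<in> D"
    then show "AE x in lborel. x \<in> X \<longrightarrow> h' x = 0"
      using D(2,3) cloc by (metis PowD subsetD)
  qed
  with h'(2) have "AE x in lborel. x \<in> \<Omega> \<longrightarrow> h x = 0"
    by eventually_elim (metis D(4) H_def UnionE indicator_simps(1) mult_1)
  from AE_completion[OF this] show ?thesis
    using lm by (simp add: AE_restrict_space_iff)
qed


section \<open>Weak gradients: uniqueness, linear and complex combinations\<close>

lemma test_functions_in_L2: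
  fixes \<phi> :: "real^'d \<Rightarrow> real"
  assumes "open \<Omega>" "bounded \<Omega>" "\<phi> \<in> test_functions \<Omega>"
  shows "\<phi> \<in> L2 \<Omega>" "partial i \<phi> \<in> L2 \<Omega>"
  using assms by (auto simp: test_functions_def
      intro!: continuous_on_closure_in_L2 C_infinity_continuous_on C_infinityD(2))

text \<open>Each component of the difference integrates to zero against every test function. Taking
  inner products with basis vectors reduces a vector-valued codomain to the real fundamental
  lemma.\<close>

lemma has_weak_gradient_unique:
  fixes v :: "real^'d \<Rightarrow> 'b::euclidean_space"
  assumes \<Omega>: "open \<Omega>" "bounded \<Omega>"
    and g: "has_weak_gradient \<Omega> v g" and g': "has_weak_gradient \<Omega> v g'"
  shows "AE x in lebesgue_on \<Omega>. g x = g' x"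
proof -
  have comp: "AE x in lebesgue_on \<Omega>. (g x $ i - g' x $ i) \<bullet> b = 0" for i b
  proof (rule fundamental_lemma_of_calculus_of_variations[OF \<Omega>])
    have L: "(\<lambda>x. g x $ i) \<in> L2 \<Omega>" "(\<lambda>x. g' x $ i) \<in> L2 \<Omega>"
      using g g' by (auto simp: has_weak_gradient_def)
    have d: "(\<lambda>x. g x $ i + (-1) *\<^sub>R (g' x $ i)) \<in> L2 \<Omega>"
      by (intro L2_add L2_scaleR L)
    have "(\<lambda>x. (g x $ i + (-1) *\<^sub>R (g' x $ i)) \<bullet> b) \<in> L2 \<Omega>"
      using d by (intro L2_bound[OF d, of _ "norm b"])
        (auto simp: L2_def mult.commute[of "norm b"] Cauchy_Schwarz_ineq2)
    then show "(\<lambda>x. (g x $ i - g' x $ i) \<bullet> b) \<in> L2 \<Omega>" by simp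
    fix \<phi> :: "real^'d \<Rightarrow> real" assume \<phi>: "\<phi> \<in> test_functions \<Omega>"
    note int = L2_integrable_scaleR[OF test_functions_in_L2(1)[OF \<Omega> \<phi>] L(1)]
      L2_integrable_scaleR[OF test_functions_in_L2(1)[OF \<Omega> \<phi>] L(2)]
    have "(LINT x|lebesgue_on \<Omega>. partial i \<phi> x *\<^sub>R v x) = - (LINT x|lebesgue_on \<Omega>. \<phi> x *\<^sub>R (g x $ i))"
      using g \<phi> unfolding has_weak_gradient_def by blast
    moreover have "(LINT x|lebesgue_on \<Omega>. partial i \<phi> x *\<^sub>R v x) = - (LINT x|lebesgue_on \<Omega>. \<phi> x *\<^sub>R (g' x $ i))"
      using g' \<phi> unfolding has_weak_gradient_def by blast
    ultimately have "(LINT x|lebesgue_on \<Omega>. \<phi> x *\<^sub>R (g x $ i)) = (LINT x|lebesgue_on \<Omega>. \<phi> x *\<^sub>R (g' x $ i))"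
      by simp
    then have "(LINT x|lebesgue_on \<Omega>. \<phi> x *\<^sub>R (g x $ i) - \<phi> x *\<^sub>R (g' x $ i)) = 0"
      using int by simp
    then have "(LINT x|lebesgue_on \<Omega>. (\<phi> x *\<^sub>R (g x $ i) - \<phi> x *\<^sub>R (g' x $ i)) \<bullet> b) = 0"
      using int by (subst integral_inner_left) auto
    then show "(LINT x|lebesgue_on \<Omega>. \<phi> x * ((g x $ i - g' x $ i) \<bullet> b)) = 0"
      by (simp add: inner_diff_left right_diff_distrib)
  qed
  have "AE x in lebesgue_on \<Omega>. \<forall>i. \<forall>b\<in>Basis. (g x $ i - g' x $ i) \<bullet> b = 0"
    unfolding AE_all_countable
    by (intro allI AE_ball_countable' comp countable_finite finite_Basis)
  then show ?thesis
  proof eventually_elim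
    case (elim x)
    have "g x $ i - g' x $ i = 0" for i
      by (rule euclidean_eqI) (simp only: elim inner_zero_left)
    then show ?case by (simp add: vec_eq_iff)
  qed
qed

lemma has_weak_gradient_linear:
  fixes v w :: "real^'d \<Rightarrow> 'b::euclidean_space"
  assumes \<Omega>: "open \<Omega>" "bounded \<Omega>" and vw: "v \<in> L2 \<Omega>" "w \<in> L2 \<Omega>"
    and g: "has_weak_gradient \<Omega> v g" and g': "has_weak_gradient \<Omega> w g'"
  shows "has_weak_gradient \<Omega> (\<lambda>x. a *\<^sub>R v x + b *\<^sub>R w x) (\<lambda>x. a *\<^sub>R g x + b *\<^sub>R g' x)"
  unfolding has_weak_gradient_def
proof (intro conjI allI ballI)
  fix i
  have L: "(\<lambda>x. g x $ i) \<in> L2 \<Omega>" "(\<lambda>x. g' x $ i) \<in> L2 \<Omega>"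
    using g g' by (auto simp: has_weak_gradient_def)
  then show "(\<lambda>x. (a *\<^sub>R g x + b *\<^sub>R g' x) $ i) \<in> L2 \<Omega>"
    by (simp add: L2_add L2_scaleR)
  fix \<phi> :: "real^'d \<Rightarrow> real" assume \<phi>: "\<phi> \<in> test_functions \<Omega>"
  note t = test_functions_in_L2[OF \<Omega> \<phi>]
  have *: "(LINT x|lebesgue_on \<Omega>. f x *\<^sub>R (a *\<^sub>R u x + b *\<^sub>R z x))
      = a *\<^sub>R (LINT x|lebesgue_on \<Omega>. f x *\<^sub>R u x) + b *\<^sub>R (LINT x|lebesgue_on \<Omega>. f x *\<^sub>R z x)"
    if "f \<in> L2 \<Omega>" "u \<in> L2 \<Omega>" "z \<in> L2 \<Omega>" for f :: "real^'d \<Rightarrow> real" and u z :: "real^'d \<Rightarrow> 'b"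
  proof -
    have "(LINT x|lebesgue_on \<Omega>. f x *\<^sub>R (a *\<^sub>R u x + b *\<^sub>R z x))
        = (LINT x|lebesgue_on \<Omega>. a *\<^sub>R (f x *\<^sub>R u x) + b *\<^sub>R (f x *\<^sub>R z x))"
      by (simp add: scaleR_add_right mult.commute)
    also have "\<dots> = a *\<^sub>R (LINT x|lebesgue_on \<Omega>. f x *\<^sub>R u x) + b *\<^sub>R (LINT x|lebesgue_on \<Omega>. f x *\<^sub>R z x)"
      using L2_integrable_scaleR[OF that(1,2)] L2_integrable_scaleR[OF that(1,3)]
      by (simp only: Bochner_Integration.integral_add integrable_scaleR_right integral_scaleR_right)
    finally show ?thesis .
  qed
  show "(LINT x|lebesgue_on \<Omega>. partial i \<phi> x *\<^sub>R (a *\<^sub>R v x + b *\<^sub>R w x))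
      = - (LINT x|lebesgue_on \<Omega>. \<phi> x *\<^sub>R ((a *\<^sub>R g x + b *\<^sub>R g' x) $ i))"
    using g g' \<phi> *[OF t(2) vw, of i] *[OF t(1) L] by (simp add: has_weak_gradient_def)
qed

text \<open>Test functions are real-valued, so the defining identity splits into its real and
  imaginary parts.\<close>

lemma has_weak_gradient_complex:
  fixes v w :: "real^'d \<Rightarrow> real"
  assumes \<Omega>: "open \<Omega>" "bounded \<Omega>" and vw: "v \<in> L2 \<Omega>" "w \<in> L2 \<Omega>"
    and g: "has_weak_gradient \<Omega> v g" and g': "has_weak_gradient \<Omega> w g'"
  shows "has_weak_gradient \<Omega> (\<lambda>x. complex_of_real (v x) + \<i> * complex_of_real (w x))
    (\<lambda>x. \<chi> i. complex_of_real (g x $ i) + \<i> * complex_of_real (g' x $ i))"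
  unfolding has_weak_gradient_def
proof (intro conjI allI ballI)
  fix i
  have L: "(\<lambda>x. g x $ i) \<in> L2 \<Omega>" "(\<lambda>x. g' x $ i) \<in> L2 \<Omega>"
    using g g' by (auto simp: has_weak_gradient_def)
  then show "(\<lambda>x. (\<chi> i. complex_of_real (g x $ i) + \<i> * complex_of_real (g' x $ i)) $ i) \<in> L2 \<Omega>"
    by (simp add: L2_complex_combination)
  fix \<phi> :: "real^'d \<Rightarrow> real" assume \<phi>: "\<phi> \<in> test_functions \<Omega>"
  note t = test_functions_in_L2[OF \<Omega> \<phi>]
  have *: "(LINT x|lebesgue_on \<Omega>. f x *\<^sub>R (complex_of_real (u x) + \<i> * complex_of_real (z x)))
      = complex_of_real (LINT x|lebesgue_on \<Omega>. f x *\<^sub>R u x) + \<i> * complex_of_real (LINT x|lebesgue_on \<Omega>. f x *\<^sub>R z x)"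
    if "f \<in> L2 \<Omega>" "u \<in> L2 \<Omega>" "z \<in> L2 \<Omega>" for f u z :: "real^'d \<Rightarrow> real"
  proof -
    have "(LINT x|lebesgue_on \<Omega>. f x *\<^sub>R (complex_of_real (u x) + \<i> * complex_of_real (z x)))
        = (LINT x|lebesgue_on \<Omega>. complex_of_real (f x *\<^sub>R u x) + \<i> * complex_of_real (f x *\<^sub>R z x))"
      by (simp add: scaleR_conv_of_real algebra_simps)
    also have "\<dots> = (LINT x|lebesgue_on \<Omega>. complex_of_real (f x *\<^sub>R u x))
        + (LINT x|lebesgue_on \<Omega>. \<i> * complex_of_real (f x *\<^sub>R z x))"
      using L2_integrable_scaleR[OF that(1,2)] L2_integrable_scaleR[OF that(1,3)]
      by (intro Bochner_Integration.integral_add integrable_mult_right integrable_of_real)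
    finally show ?thesis
      by (simp only: integral_mult_right_zero integral_complex_of_real)
  qed
  show "(LINT x|lebesgue_on \<Omega>. partial i \<phi> x *\<^sub>R (complex_of_real (v x) + \<i> * complex_of_real (w x)))
      = - (LINT x|lebesgue_on \<Omega>. \<phi> x *\<^sub>R ((\<chi> i. complex_of_real (g x $ i) + \<i> * complex_of_real (g' x $ i)) $ i))"
    using g g' \<phi> *[OF t(2) vw, of i] *[OF t(1) L] by (simp add: has_weak_gradient_def)
qed

section \<open>Riesz representation in finite-dimensional function spaces\<close>

lemma sum_fun_apply: "(\<Sum>i\<in>A. f i) x = (\<Sum>i\<in>A. f i x)"
  for f :: "'i \<Rightarrow> 'a \<Rightarrow> 'b::comm_monoid_add"
  by (induction A rule: infinite_finite_induct) auto

text \<open>Addition and scaling are pointwise; this makes span and linear independence available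
  for real functions on any type.\<close>

interpretation fun_vs: vector_space "\<lambda>(c::real) (f :: 'a \<Rightarrow> real) x. c * f x"
  by unfold_locales (auto simp: fun_eq_iff algebra_simps)

text \<open>The form \<open>ip\<close> is constrained on \<open>V\<close> only. Finite dimension is
  containment in the span of a finite set that need not lie in \<open>V\<close>; for finite elements
  the spanning functions will be truncated monomials, which are in general discontinuous.\<close>

locale finite_dim_inner_product =
  fixes V :: "('a \<Rightarrow> real) set" and ip :: "('a \<Rightarrow> real) \<Rightarrow> ('a \<Rightarrow> real) \<Rightarrow> real"
  assumes zero_in: "(\<lambda>x. 0) \<in> V"
    and lin_in: "f \<in> V \<Longrightarrow> g \<in> V \<Longrightarrow> (\<lambda>x. a * f x + b * g x) \<in> V"
    and ip_lin: "f \<in> V \<Longrightarrow> g \<in> V \<Longrightarrow> h \<in> V \<Longrightarrow> ip (\<lambda>x. a * f x + b * g x) h = a * ip f h + b * ip g h"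
    and ip_sym: "f \<in> V \<Longrightarrow> g \<in> V \<Longrightarrow> ip f g = ip g f"
    and ip_nonneg: "f \<in> V \<Longrightarrow> 0 \<le> ip f f"
    and ip_definite: "f \<in> V \<Longrightarrow> ip f f = 0 \<Longrightarrow> f = (\<lambda>x. 0)"
    and finite_dim: "\<exists>B. finite B \<and> V \<subseteq> fun_vs.span B"
begin

lemma sum_in:
  assumes "finite S" "S \<subseteq> V"
  shows "(\<lambda>x. \<Sum>e\<in>S. c e * e x) \<in> V"
  using assms
proof (induction S rule: finite_induct)
  case empty then show ?case using zero_in by simp
next
  case (insert e S)
  then show ?case using lin_in[of e "\<lambda>x. \<Sum>e\<in>S. c e * e x" "c e" 1] by simp
qed

lemma linear_functional_sum:
  fixes L :: "('a \<Rightarrow> real) \<Rightarrow> real"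
  assumes L: "\<And>a b f g. f \<in> V \<Longrightarrow> g \<in> V \<Longrightarrow> L (\<lambda>x. a * f x + b * g x) = a * L f + b * L g"
    and "finite S" "S \<subseteq> V"
  shows "L (\<lambda>x. \<Sum>e\<in>S. c e * e x) = (\<Sum>e\<in>S. c e * L e)"
  using assms(2,3)
proof (induction S rule: finite_induct)
  case empty then show ?case using L[OF zero_in zero_in, of 0 0] by simp
next
  case (insert e S)
  then show ?case using L[of e "\<lambda>x. \<Sum>e\<in>S. c e * e x" "c e" 1] sum_in[of S c] by simp
qed

definition orthonormal :: "('a \<Rightarrow> real) set \<Rightarrow> bool" where
  "orthonormal S \<longleftrightarrow> finite S \<and> S \<subseteq> V \<and> (\<forall>e\<in>S. \<forall>e'\<in>S. ip e e' = (if e = e' then 1 else 0))"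

lemma ip_sum_orthonormal:
  assumes S: "orthonormal S" and e: "e \<in> S"
  shows "ip (\<lambda>x. \<Sum>e\<in>S. c e * e x) e = c e"
proof -
  have "ip (\<lambda>x. \<Sum>e\<in>S. c e * e x) e = (\<Sum>e'\<in>S. c e' * ip e' e)"
    using S e by (intro linear_functional_sum[of "\<lambda>f. ip f e"] ip_lin) (auto simp: orthonormal_def)
  also have "\<dots> = (\<Sum>e'\<in>S. if e' = e then c e else 0)"
    using S e by (intro sum.cong) (auto simp: orthonormal_def)
  finally show ?thesis using S e by (simp add: orthonormal_def)
qed

text \<open>Orthonormal systems are linearly independent, and an independent set in the span of a
  finite set \<open>B\<close> has at most \<open>card B\<close> elements.\<close>

lemma orthonormal_card_bounded: "\<exists>n. \<forall>S. orthonormal S \<longrightarrow> card S \<le> n"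
proof -
  obtain B where B: "finite B" "V \<subseteq> fun_vs.span B"
    using finite_dim by blast
  have "card S \<le> card B" if S: "orthonormal S" for S
  proof -
    have "fun_vs.independent S"
    proof (rule fun_vs.independent_if_scalars_zero)
      fix c e assume 0: "(\<Sum>e\<in>S. (\<lambda>x. c e * e x)) = 0" and e: "e \<in> S"
      \<comment> \<open>The zero function is written as a combination of \<open>e\<close> with
        itself, so that linearity of \<open>ip\<close> evaluates it to 0.\<close>
      have "(\<lambda>x. \<Sum>e\<in>S. c e * e x) = (\<lambda>x. 0 * e x + 0 * e x)"
        using fun_cong[OF 0] by (auto simp: sum_fun_apply)
      then have "c e = ip (\<lambda>x. 0 * e x + 0 * e x) e"
        using ip_sum_orthonormal[OF S e, of c] by simp
      also have "\<dots> = 0"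
        using S e by (subst ip_lin) (auto simp: orthonormal_def)
      finally show "c e = 0" .
    qed (use S in \<open>simp add: orthonormal_def\<close>)
    moreover have "S \<subseteq> fun_vs.span B"
      using S B(2) by (auto simp: orthonormal_def)
    ultimately show ?thesis
      using fun_vs.independent_span_bound[OF B(1)] by blast
  qed
  then show ?thesis by blast
qed

text \<open>A maximality argument in place of Gram-Schmidt: an orthonormal system of greatest
  cardinality must already expand every \<open>f\<close>, since otherwise the normalized residual of
  \<open>f\<close> could be added to it.\<close>

lemma orthonormal_basis_exists:
  obtains S where "orthonormal S" "\<And>f. f \<in> V \<Longrightarrow> f = (\<lambda>x. \<Sum>e\<in>S. ip f e * e x)"
proof -
  obtain n where n: "\<And>S. orthonormal S \<Longrightarrow> card S \<le> n" using orthonormal_card_bounded by blast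
  have "orthonormal {}" by (simp add: orthonormal_def)
  then obtain S where S: "orthonormal S" and max: "\<And>S'. orthonormal S' \<Longrightarrow> card S' \<le> card S"
    using ex_has_greatest_nat[of orthonormal "{}"  card "Suc n"] n
    by (auto simp: less_Suc_eq_le)
  have "f = (\<lambda>x. \<Sum>e\<in>S. ip f e * e x)" if f: "f \<in> V" for f
  proof (rule ccontr)
    assume ne: "f \<noteq> (\<lambda>x. \<Sum>e\<in>S. ip f e * e x)"
    define s where "s = (\<lambda>x. \<Sum>e\<in>S. ip f e * e x)"
    have sV: "s \<in> V" unfolding s_def using S by (intro sum_in) (auto simp: orthonormal_def)
    define g where "g = (\<lambda>x. 1 * f x + (-1) * s x)"
    have gV: "g \<in> V" unfolding g_def by (rule lin_in[OF f sV])
    have ge: "ip g e = 0" if "e \<in> S" for e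
    proof -
      have "e \<in> V" using S that by (auto simp: orthonormal_def)
      then show ?thesis
        unfolding g_def ip_lin[OF f sV \<open>e \<in> V\<close>] using ip_sum_orthonormal[OF S that, of "ip f"]
        by (simp add: s_def)
    qed
    have "g \<noteq> (\<lambda>x. 0)" using ne by (auto simp: g_def s_def fun_eq_iff)
    then have pos: "ip g g > 0" using ip_nonneg[OF gV] ip_definite[OF gV] by fastforce
    \<comment> \<open>\<open>u\<close> is the residual scaled to unit length; its vanishing second
      term only gives it the two-term shape in which linearity is stated.\<close>
    define a where "a = 1 / sqrt (ip g g)"
    define u where "u = (\<lambda>x. a * g x + 0 * g x)"
    have uV: "u \<in> V" unfolding u_def by (rule lin_in[OF gV gV])
    have ip_u: "ip u h = a * ip g h" if "h \<in> V" for h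
      unfolding u_def ip_lin[OF gV gV that] by simp
    have "ip u u = a * (a * ip g g)"
      using ip_u[OF uV] ip_u[OF gV] ip_sym[OF gV uV] by simp
    also have "\<dots> = 1" using pos by (simp add: a_def real_div_sqrt field_simps)
    finally have uu: "ip u u = 1" .
    have ue: "ip u e = 0" "ip e u = 0" if "e \<in> S" for e
    proof -
      have "e \<in> V" using S that by (auto simp: orthonormal_def)
      then show "ip u e = 0" "ip e u = 0" using ip_u ge[OF that] ip_sym uV by auto
    qed
    have "u \<notin> S" using uu ue by force
    moreover have "orthonormal (insert u S)"
      using S uV uu ue \<open>u \<notin> S\<close> unfolding orthonormal_def by auto
    ultimately show False
      using max[of "insert u S"] S by (simp add: orthonormal_def)
  qed
  with S that show ?thesis by blast
qed

text \<open>The representer has coefficient \<open>L e\<close> at each vector \<open>e\<close> of an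
  orthonormal basis; expanding \<open>f\<close> in the same basis and using linearity of
  \<open>L\<close> identifies the two sides.\<close>

lemma riesz_representation:
  assumes L: "\<And>a b f g. f \<in> V \<Longrightarrow> g \<in> V \<Longrightarrow> L (\<lambda>x. a * f x + b * g x) = a * L f + b * L g"
  shows "\<exists>w\<in>V. \<forall>f\<in>V. ip w f = L f"
proof -
  obtain S where S: "orthonormal S" and exp: "\<And>f. f \<in> V \<Longrightarrow> f = (\<lambda>x. \<Sum>e\<in>S. ip f e * e x)"
    using orthonormal_basis_exists by blast
  have fin: "finite S" "S \<subseteq> V" using S by (auto simp: orthonormal_def)
  define w where "w = (\<lambda>x. \<Sum>e\<in>S. L e * e x)"
  have wV: "w \<in> V" unfolding w_def using fin by (rule sum_in)
  have "ip w f = L f" if f: "f \<in> V" for f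
  proof -
    have "ip w f = (\<Sum>e\<in>S. L e * ip e f)"
      unfolding w_def using fin f by (intro linear_functional_sum[of "\<lambda>g. ip g f"] ip_lin)
    also have "\<dots> = (\<Sum>e\<in>S. ip f e * L e)"
      using fin f by (intro sum.cong) (auto simp: ip_sym)
    also have "\<dots> = L (\<lambda>x. \<Sum>e\<in>S. ip f e * e x)"
      using L fin by (intro linear_functional_sum[symmetric])
    finally show ?thesis using exp[OF f] by simp
  qed
  with wV show ?thesis by blast
qed

lemma eq_if_ip_eq:
  assumes w: "w \<in> V" "w' \<in> V" and eq: "\<And>f. f \<in> V \<Longrightarrow> ip w f = ip w' f"
  shows "w = w'"
proof -
  define d where "d = (\<lambda>x. 1 * w x + (-1) * w' x)"
  have d: "d \<in> V" unfolding d_def by (rule lin_in[OF w])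
  have "ip d d = 1 * ip w d + (-1) * ip w' d"
    using ip_lin[OF w d, of 1 "-1"] by (simp only: d_def)
  then have "d = (\<lambda>x. 0)" using eq[OF d] d by (intro ip_definite) simp_all
  then show ?thesis by (simp add: d_def fun_eq_iff)
qed

end

section \<open>The finite element space\<close>

lemma C_infinity_lincomb:
  fixes f g :: "real^'d \<Rightarrow> real"
  assumes "C_infinity f" "C_infinity g"
  shows "C_infinity (\<lambda>x. a * f x + b * g x)"
proof -
  have "leibniz_closure (\<lambda>x. a * f x + b * g x)"
    using assms by (intro leibniz_closure.intros C_infinity_const)
  then show ?thesis by (rule C_infinity_if_leibniz_closure)
qed

lemma test_functions_lincomb:
  fixes f g :: "real^'d \<Rightarrow> real"
  assumes f: "f \<in> test_functions \<Omega>" and g: "g \<in> test_functions \<Omega>"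
  shows "(\<lambda>x. a * f x + b * g x) \<in> test_functions \<Omega>"
proof -
  let ?A = "closure {x. f x \<noteq> 0}" and ?B = "closure {x. g x \<noteq> 0}"
  have AB: "compact (?A \<union> ?B)" "?A \<union> ?B \<subseteq> \<Omega>"
    using f g by (auto simp: test_functions_def intro!: compact_Un)
  have sub: "closure {x. a * f x + b * g x \<noteq> 0} \<subseteq> ?A \<union> ?B"
    unfolding closure_Un[symmetric] by (intro closure_mono) auto
  then have "compact (closure {x. a * f x + b * g x \<noteq> 0})"
    using bounded_subset[OF compact_imp_bounded[OF AB(1)] sub] by (simp add: compact_eq_bounded_closed)
  then show ?thesis
    using sub AB(2) f g C_infinity_lincomb by (auto simp: test_functions_def)
qed

lemma partial_lincomb:
  fixes f g :: "real^'d \<Rightarrow> real"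
  assumes f: "f differentiable (at x)" and g: "g differentiable (at x)"
  shows "partial i (\<lambda>x. a * f x + b * g x) x = a * partial i f x + b * partial i g x"
proof -
  have "((\<lambda>x. a * f x + b * g x) has_derivative
      (\<lambda>h. a * frechet_derivative f (at x) h + b * frechet_derivative g (at x) h)) (at x)"
    using f g by (intro has_derivative_add has_derivative_mult_right) (simp_all add: frechet_derivative_works[symmetric])
  from partial_eqI[OF this] show ?thesis by (simp add: partial_def)
qed

lemma L2norm_nonneg: "0 \<le> L2norm \<Omega> f"
  by (simp add: L2norm_def)

lemma L2norm_square: "(L2norm \<Omega> f)\<^sup>2 = (LINT x|lebesgue_on \<Omega>. (norm (f x))\<^sup>2)"
  by (simp add: L2norm_def)

text \<open>The pointwise bound (a u + b z)^2 <= 2 a^2 u^2 + 2 b^2 z^2, once integrated, squeezes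
  the squared norm to zero and replaces the triangle inequality for \<open>L2norm\<close>.\<close>

lemma L2norm_lincomb_tendsto_0:
  fixes u z :: "nat \<Rightarrow> real^'d \<Rightarrow> real"
  assumes L: "\<And>m. u m \<in> L2 \<Omega>" "\<And>m. z m \<in> L2 \<Omega>"
    and u: "(\<lambda>m. L2norm \<Omega> (u m)) \<longlonglongrightarrow> 0" and z: "(\<lambda>m. L2norm \<Omega> (z m)) \<longlonglongrightarrow> 0"
  shows "(\<lambda>m. L2norm \<Omega> (\<lambda>x. a * u m x + b * z m x)) \<longlonglongrightarrow> 0"
proof -
  let ?r = "\<lambda>m. 2 * a\<^sup>2 * (L2norm \<Omega> (u m))\<^sup>2 + 2 * b\<^sup>2 * (L2norm \<Omega> (z m))\<^sup>2"
  have le: "(L2norm \<Omega> (\<lambda>x. a * u m x + b * z m x))\<^sup>2 \<le> ?r m" for m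
  proof -
    have int: "integrable (lebesgue_on \<Omega>) (\<lambda>x. (u m x)\<^sup>2)" "integrable (lebesgue_on \<Omega>) (\<lambda>x. (z m x)\<^sup>2)"
      using L(1)[of m] L(2)[of m] by (auto simp: L2_def)
    have "(\<lambda>x. a *\<^sub>R u m x + b *\<^sub>R z m x) \<in> L2 \<Omega>"
      by (intro L2_add L2_scaleR L)
    then have int2: "integrable (lebesgue_on \<Omega>) (\<lambda>x. (a * u m x + b * z m x)\<^sup>2)"
      by (simp add: L2_def)
    have "(a * u m x + b * z m x)\<^sup>2 \<le> 2 * a\<^sup>2 * (u m x)\<^sup>2 + 2 * b\<^sup>2 * (z m x)\<^sup>2" for x
      using sum_squares_bound[of "a * u m x" "b * z m x"] by (simp add: power2_sum power_mult_distrib)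
    then have "(LINT x|lebesgue_on \<Omega>. (a * u m x + b * z m x)\<^sup>2)
        \<le> (LINT x|lebesgue_on \<Omega>. 2 * a\<^sup>2 * (u m x)\<^sup>2 + 2 * b\<^sup>2 * (z m x)\<^sup>2)"
      using int int2 by (intro integral_mono) auto
    also have "\<dots> = 2 * a\<^sup>2 * (LINT x|lebesgue_on \<Omega>. (u m x)\<^sup>2) + 2 * b\<^sup>2 * (LINT x|lebesgue_on \<Omega>. (z m x)\<^sup>2)"
      using int by simp
    finally show ?thesis by (simp add: L2norm_square)
  qed
  have "?r \<longlonglongrightarrow> 2 * a\<^sup>2 * 0\<^sup>2 + 2 * b\<^sup>2 * 0\<^sup>2"
    by (intro tendsto_intros u z)
  then have r: "?r \<longlonglongrightarrow> 0" by simp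
  have "(\<lambda>m. (L2norm \<Omega> (\<lambda>x. a * u m x + b * z m x))\<^sup>2) \<longlonglongrightarrow> 0"
    by (rule tendsto_sandwich[OF _ _ tendsto_const r]) (simp_all add: le)
  then have "(\<lambda>m. sqrt ((L2norm \<Omega> (\<lambda>x. a * u m x + b * z m x))\<^sup>2)) \<longlonglongrightarrow> sqrt 0"
    by (rule tendsto_real_sqrt)
  then show ?thesis by (simp add: L2norm_nonneg)
qed

text \<open>The same linear combination is taken of the functions, of their weak gradients
  \<open>F\<close> and \<open>G\<close> and of the approximating test functions; both error
  sequences are then combinations of null sequences.\<close>

lemma H10_lincomb:
  fixes f g :: "real^'d \<Rightarrow> real"
  assumes \<Omega>: "open \<Omega>" "bounded \<Omega>" and f: "f \<in> H10 \<Omega>" and g: "g \<in> H10 \<Omega>"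
  shows "(\<lambda>x. a * f x + b * g x) \<in> H10 \<Omega>"
proof -
  have L: "f \<in> L2 \<Omega>" "g \<in> L2 \<Omega>" using f g by (auto simp: H10_def)
  obtain F \<phi> where F: "has_weak_gradient \<Omega> f F" and \<phi>: "\<And>m::nat. \<phi> m \<in> test_functions \<Omega>"
    "(\<lambda>m. L2norm \<Omega> (\<lambda>x. \<phi> m x - f x)) \<longlonglongrightarrow> 0"
    "\<And>i. (\<lambda>m. L2norm \<Omega> (\<lambda>x. partial i (\<phi> m) x - F x $ i)) \<longlonglongrightarrow> 0"
    using f unfolding H10_def by blast
  obtain G \<psi> where G: "has_weak_gradient \<Omega> g G" and \<psi>: "\<And>m::nat. \<psi> m \<in> test_functions \<Omega>"
    "(\<lambda>m. L2norm \<Omega> (\<lambda>x. \<psi> m x - g x)) \<longlonglongrightarrow> 0"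
    "\<And>i. (\<lambda>m. L2norm \<Omega> (\<lambda>x. partial i (\<psi> m) x - G x $ i)) \<longlonglongrightarrow> 0"
    using g unfolding H10_def by blast
  define H where "H x = a *\<^sub>R F x + b *\<^sub>R G x" for x
  define \<eta> where "\<eta> m x = a * \<phi> m x + b * \<psi> m x" for m x
  have d: "(\<lambda>x. u x - z x) \<in> L2 \<Omega>" if "u \<in> L2 \<Omega>" "z \<in> L2 \<Omega>" for u z :: "real^'d \<Rightarrow> real"
    using L2_add[OF that(1) L2_scaleR[OF that(2), of "-1"]] by simp
  have LFG: "(\<lambda>x. F x $ i) \<in> L2 \<Omega>" "(\<lambda>x. G x $ i) \<in> L2 \<Omega>" for i
    using F G by (auto simp: has_weak_gradient_def)
  have "(\<lambda>x. a *\<^sub>R f x + b *\<^sub>R g x) \<in> L2 \<Omega>" by (intro L2_add L2_scaleR L)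
  moreover have "has_weak_gradient \<Omega> (\<lambda>x. a *\<^sub>R f x + b *\<^sub>R g x) H"
    unfolding H_def by (rule has_weak_gradient_linear[OF \<Omega> L F G])
  moreover have "\<eta> m \<in> test_functions \<Omega>" for m
    using test_functions_lincomb[OF \<phi>(1) \<psi>(1)] by (simp add: \<eta>_def[abs_def])
  moreover have "(\<lambda>m. L2norm \<Omega> (\<lambda>x. \<eta> m x - (a *\<^sub>R f x + b *\<^sub>R g x))) \<longlonglongrightarrow> 0"
    using L2norm_lincomb_tendsto_0[OF d[OF test_functions_in_L2(1)[OF \<Omega> \<phi>(1)] L(1)]
        d[OF test_functions_in_L2(1)[OF \<Omega> \<psi>(1)] L(2)] \<phi>(2) \<psi>(2), of a b]
    by (simp add: \<eta>_def algebra_simps)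
  moreover have "(\<lambda>m. L2norm \<Omega> (\<lambda>x. partial i (\<eta> m) x - H x $ i)) \<longlonglongrightarrow> 0" for i
  proof -
    have "partial i (\<eta> m) x = a * partial i (\<phi> m) x + b * partial i (\<psi> m) x" for m x
      unfolding \<eta>_def using \<phi>(1)[of m] \<psi>(1)[of m]
      by (intro partial_lincomb) (auto simp: test_functions_def C_infinityD(1))
    then show ?thesis
      using L2norm_lincomb_tendsto_0[OF d[OF test_functions_in_L2(2)[OF \<Omega> \<phi>(1)] LFG(1)[of i]]
          d[OF test_functions_in_L2(2)[OF \<Omega> \<psi>(1)] LFG(2)[of i]] \<phi>(3) \<psi>(3), of a b]
      by (simp add: H_def algebra_simps)
  qed
  ultimately have "(\<lambda>x. a *\<^sub>R f x + b *\<^sub>R g x) \<in> H10 \<Omega>"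
    unfolding H10_def by blast
  then show ?thesis by simp
qed

lemma zero_in_H10: "(\<lambda>x::real^'d. 0::real) \<in> H10 \<Omega>"
proof -
  have C: "C_infinity (\<lambda>x::real^'d. 0::real)" by (rule C_infinity_const)
  have p: "partial i (\<lambda>x::real^'d. 0::real) = (\<lambda>x. 0)" for i
    using partial_eqI[OF has_derivative_const] by auto
  have "(\<lambda>x::real^'d. 0::real) \<in> test_functions \<Omega>" using C by (simp add: test_functions_def)
  then show ?thesis
    unfolding H10_def has_weak_gradient_def
    by (auto simp: L2_def L2norm_def p intro!: exI[of _ "\<lambda>x. 0"] exI[of _ "\<lambda>m x. 0"])
qed

section \<open>Piecewise polynomials and the dimension of the finite element space\<close>

lemma poly_total_on_lincomb:
  assumes "poly_total_on l K f" "poly_total_on l K g"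
  shows "poly_total_on l K (\<lambda>x. a * f x + b * g x)"
proof -
  obtain c d where "\<And>x. x \<in> K \<Longrightarrow> f x = (\<Sum>\<alpha> | (\<Sum>i\<in>UNIV. \<alpha> i) \<le> l. c \<alpha> * (\<Prod>i\<in>UNIV. (x $ i) ^ \<alpha> i))"
    "\<And>x. x \<in> K \<Longrightarrow> g x = (\<Sum>\<alpha> | (\<Sum>i\<in>UNIV. \<alpha> i) \<le> l. d \<alpha> * (\<Prod>i\<in>UNIV. (x $ i) ^ \<alpha> i))"
    using assms unfolding poly_total_on_def by blast
  then show ?thesis
    unfolding poly_total_on_def
    by (intro exI[of _ "\<lambda>\<alpha>. a * c \<alpha> + b * d \<alpha>"])
      (simp add: sum_distrib_left sum.distrib algebra_simps)
qed

lemma poly_each_on_lincomb: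
  assumes "poly_each_on l K f" "poly_each_on l K g"
  shows "poly_each_on l K (\<lambda>x. a * f x + b * g x)"
proof -
  obtain c d where "\<And>x. x \<in> K \<Longrightarrow> f x = (\<Sum>\<alpha> | \<forall>i. \<alpha> i \<le> l. c \<alpha> * (\<Prod>i\<in>UNIV. (x $ i) ^ \<alpha> i))"
    "\<And>x. x \<in> K \<Longrightarrow> g x = (\<Sum>\<alpha> | \<forall>i. \<alpha> i \<le> l. d \<alpha> * (\<Prod>i\<in>UNIV. (x $ i) ^ \<alpha> i))"
    using assms unfolding poly_each_on_def by blast
  then show ?thesis
    unfolding poly_each_on_def
    by (intro exI[of _ "\<lambda>\<alpha>. a * c \<alpha> + b * d \<alpha>"])
      (simp add: sum_distrib_left sum.distrib algebra_simps)
qed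

lemma Vh_real_lincomb:
  assumes \<Omega>: "open \<Omega>" "bounded \<Omega>" and f: "f \<in> Vh_real \<Omega> \<T> l" and g: "g \<in> Vh_real \<Omega> \<T> l"
  shows "(\<lambda>x. a * f x + b * g x) \<in> Vh_real \<Omega> \<T> l"
proof -
  have "continuous_on (closure \<Omega>) (\<lambda>x. a * f x + b * g x)"
    using f g by (auto simp: Vh_real_def intro!: continuous_intros)
  moreover have "(\<lambda>x. a * f x + b * g x) \<in> H10 \<Omega>"
    using f g by (intro H10_lincomb[OF \<Omega>]) (auto simp: Vh_real_def)
  ultimately show ?thesis
    using f g by (simp add: Vh_real_def poly_total_on_lincomb poly_each_on_lincomb)
qed

lemma zero_in_Vh_real: "(\<lambda>x. 0) \<in> Vh_real \<Omega> \<T> l"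
  by (auto simp: Vh_real_def zero_in_H10 poly_total_on_def poly_each_on_def intro!: exI[of _ "\<lambda>\<alpha>. 0"])

lemma finite_bounded_exponents: "finite {\<alpha> :: 'd::finite \<Rightarrow> nat. \<forall>i. \<alpha> i \<le> l}"
  using finite_set_of_finite_funs[of "UNIV :: 'd set" "{..l}" 0] by simp

text \<open>Extending the coefficients by zero allows simplices and cubes to share one finite set of
  monomials in the dimension argument.\<close>

lemma poly_total_on_imp_poly_each_on:
  fixes K :: "(real^'d) set"
  assumes "poly_total_on l K f"
  shows "poly_each_on l K f"
proof -
  obtain c where c: "\<And>x. x \<in> K \<Longrightarrow> f x = (\<Sum>\<alpha> | (\<Sum>i\<in>UNIV. \<alpha> i) \<le> l. c \<alpha> * (\<Prod>i\<in>UNIV. (x $ i) ^ \<alpha> i))"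
    using assms unfolding poly_total_on_def by blast
  have sub: "{\<alpha> :: 'd \<Rightarrow> nat. (\<Sum>i\<in>UNIV. \<alpha> i) \<le> l} \<subseteq> {\<alpha>. \<forall>i. \<alpha> i \<le> l}"
  proof safe
    fix \<alpha> :: "'d \<Rightarrow> nat" and i
    assume "(\<Sum>i\<in>UNIV. \<alpha> i) \<le> l"
    moreover have "\<alpha> i \<le> (\<Sum>i\<in>UNIV. \<alpha> i)" by (rule member_le_sum) auto
    ultimately show "\<alpha> i \<le> l" by linarith
  qed
  have "f x = (\<Sum>\<alpha> | \<forall>i. \<alpha> i \<le> l. (if (\<Sum>i\<in>UNIV. \<alpha> i) \<le> l then c \<alpha> else 0) * (\<Prod>i\<in>UNIV. (x $ i) ^ \<alpha> i))"
    if "x \<in> K" for x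
    unfolding c[OF that] using sub
    by (intro sum.mono_neutral_cong_left finite_bounded_exponents) auto
  then show ?thesis
    unfolding poly_each_on_def
    by (intro exI[of _ "\<lambda>\<alpha>. if (\<Sum>i\<in>UNIV. \<alpha> i) \<le> l then c \<alpha> else 0"] ballI)
qed

text \<open>The spanning set consists of the monomials of degree at most \<open>l\<close> in each
  variable, each cut off to the piece assigned to one element. There are finitely many elements and
  exponents, and outside the closure of \<Omega> both sides vanish.\<close>

lemma Vh_real_finite_dim:
  fixes \<Omega> :: "(real^'d) set"
  assumes "conforming_partition \<Omega> \<T>"
  shows "\<exists>B. finite B \<and> Vh_real \<Omega> \<T> l \<subseteq> fun_vs.span B"
proof -
  have T: "finite \<T>" "\<Union>\<T> = closure \<Omega>" "\<And>K. K \<in> \<T> \<Longrightarrow> is_simplex K \<or> is_cube K"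
    using assms by (auto simp: conforming_partition_def)
  \<comment> \<open>Elements overlap on faces; choosing one element for each point makes the pieces disjoint.\<close>
  define pick where "pick x = (SOME K. K \<in> \<T> \<and> x \<in> K)" for x
  have pick: "pick x \<in> \<T> \<and> x \<in> pick x" if "x \<in> closure \<Omega>" for x
  proof -
    have "\<exists>K. K \<in> \<T> \<and> x \<in> K" using that T(2) by blast
    then show ?thesis unfolding pick_def by (rule someI_ex)
  qed
  define A where "A = {\<alpha> :: 'd \<Rightarrow> nat. \<forall>i. \<alpha> i \<le> l}"
  define e where "e K \<alpha> x = (if x \<in> closure \<Omega> \<and> pick x = K then \<Prod>i\<in>UNIV. (x $ i) ^ \<alpha> i else 0)"
    for K \<alpha> and x :: "real^'d"
  define B where "B = (\<lambda>(K, \<alpha>). e K \<alpha>) ` (\<T> \<times> A)"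
  have "finite B"
    unfolding B_def A_def by (intro finite_imageI finite_cartesian_product T(1) finite_bounded_exponents)
  moreover have "f \<in> fun_vs.span B" if f: "f \<in> Vh_real \<Omega> \<T> l" for f
  proof -
    have "\<forall>K\<in>\<T>. \<exists>c. \<forall>x\<in>K. f x = (\<Sum>\<alpha>\<in>A. c \<alpha> * (\<Prod>i\<in>UNIV. (x $ i) ^ \<alpha> i))"
    proof
      fix K assume K: "K \<in> \<T>"
      have "poly_each_on l K f"
        using f K T(3)[OF K] poly_total_on_imp_poly_each_on by (auto simp: Vh_real_def)
      then show "\<exists>c. \<forall>x\<in>K. f x = (\<Sum>\<alpha>\<in>A. c \<alpha> * (\<Prod>i\<in>UNIV. (x $ i) ^ \<alpha> i))"
        by (simp add: poly_each_on_def A_def)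
    qed
    then obtain c where c: "\<And>K x. K \<in> \<T> \<Longrightarrow> x \<in> K \<Longrightarrow> f x = (\<Sum>\<alpha>\<in>A. c K \<alpha> * (\<Prod>i\<in>UNIV. (x $ i) ^ \<alpha> i))"
      by metis
    have "f = (\<Sum>K\<in>\<T>. \<Sum>\<alpha>\<in>A. (\<lambda>x. c K \<alpha> * e K \<alpha> x))"
    proof
      fix x
      show "f x = (\<Sum>K\<in>\<T>. \<Sum>\<alpha>\<in>A. (\<lambda>x. c K \<alpha> * e K \<alpha> x)) x"
      proof (cases "x \<in> closure \<Omega>")
        case True
        \<comment> \<open>Only the element chosen for \<open>x\<close> contributes, and its
          polynomial evaluates to \<open>f x\<close> there.\<close>
        have "(\<Sum>K\<in>\<T>. \<Sum>\<alpha>\<in>A. c K \<alpha> * e K \<alpha> x) = (\<Sum>K\<in>\<T>. if K = pick x then f x else 0)"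
          using True pick[OF True] c by (intro sum.cong refl) (auto simp: e_def)
        then show ?thesis using pick[OF True] T(1) by (simp add: sum_fun_apply)
      next
        case False
        then show ?thesis using f by (simp add: sum_fun_apply e_def Vh_real_def)
      qed
    qed
    moreover have "e K \<alpha> \<in> B" if "K \<in> \<T>" "\<alpha> \<in> A" for K \<alpha>
      using that by (auto simp: B_def)
    then have "(\<Sum>K\<in>\<T>. \<Sum>\<alpha>\<in>A. (\<lambda>x. c K \<alpha> * e K \<alpha> x)) \<in> fun_vs.span B"
      by (intro fun_vs.span_sum fun_vs.span_scale fun_vs.span_base)
    ultimately show ?thesis by simp
  qed
  ultimately show ?thesis by blast
qed

section \<open>The inner product on the finite element space\<close>

text \<open>The points of \<Omega> where \<open>f\<close> is nonzero form an open null set, which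
  must be empty; continuity carries the value 0 to the closure.\<close>

lemma continuous_AE_zero_imp_zero:
  fixes f :: "real^'d \<Rightarrow> real"
  assumes \<Omega>: "open \<Omega>" and f: "continuous_on (closure \<Omega>) f" and z: "AE x in lebesgue_on \<Omega>. f x = 0"
    and x: "x \<in> closure \<Omega>"
  shows "f x = 0"
proof -
  let ?N = "{x \<in> \<Omega>. f x \<noteq> 0}"
  have "?N = \<Omega> \<inter> f -` (- {0})" by auto
  then have op: "open ?N"
    using continuous_open_preimage[OF continuous_on_subset[OF f closure_subset] \<Omega>, of "- {0}"] by (simp add: open_Compl)
  have "AE x in lebesgue. x \<in> \<Omega> \<longrightarrow> f x = 0"
    using z \<Omega> by (simp add: AE_restrict_space_iff)
  then have "?N \<in> null_sets lebesgue"
    using op by (subst AE_iff_null_sets) (auto elim!: eventually_mono)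
  then have "?N = {}"
    using open_not_negligible[OF op] by (auto simp: negligible_iff_null_sets)
  then have "\<And>x. x \<in> \<Omega> \<Longrightarrow> f x = 0" by blast
  then show ?thesis by (rule continuous_constant_on_closure[OF f _ x])
qed

text \<open>Besides finite dimension, the delicate point is definiteness: functions must vanish
  everywhere, not just almost everywhere. Continuity settles the closure of \<Omega>, and the
  extension by zero settles the rest.\<close>

lemma Vh_real_finite_dim_inner_product:
  fixes \<Omega> :: "(real^'d) set"
  assumes \<Omega>: "open \<Omega>" "bounded \<Omega>" and T: "conforming_partition \<Omega> \<T>"
  shows "finite_dim_inner_product (Vh_real \<Omega> \<T> l) (\<lambda>f g. LINT x|lebesgue_on \<Omega>. f x * g x)"
proof
  have L: "f \<in> L2 \<Omega>" if "f \<in> Vh_real \<Omega> \<T> l" for f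
    using that by (auto simp: Vh_real_def H10_def)
  note int = L2_integrable_mult[OF L L]
  show "(\<lambda>x. 0) \<in> Vh_real \<Omega> \<T> l" by (rule zero_in_Vh_real)
  fix f g h :: "real^'d \<Rightarrow> real" and a b :: real
  assume f: "f \<in> Vh_real \<Omega> \<T> l"
  show "0 \<le> (LINT x|lebesgue_on \<Omega>. f x * f x)" by simp
  show "f = (\<lambda>x. 0)" if 0: "(LINT x|lebesgue_on \<Omega>. f x * f x) = 0"
  proof
    fix x
    have "AE x in lebesgue_on \<Omega>. f x * f x = 0"
      using 0 int[OF f f] by (subst integral_nonneg_eq_0_iff_AE[symmetric]) auto
    then have "AE x in lebesgue_on \<Omega>. f x = 0" by simp
    then show "f x = 0"
      using f continuous_AE_zero_imp_zero[OF \<Omega>(1), of f x] by (auto simp: Vh_real_def)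
  qed
  assume g: "g \<in> Vh_real \<Omega> \<T> l"
  show "(\<lambda>x. a * f x + b * g x) \<in> Vh_real \<Omega> \<T> l" by (rule Vh_real_lincomb[OF \<Omega> f g])
  show "(LINT x|lebesgue_on \<Omega>. f x * g x) = (LINT x|lebesgue_on \<Omega>. g x * f x)"
    by (simp add: mult.commute)
  assume h: "h \<in> Vh_real \<Omega> \<T> l"
  have "(LINT x|lebesgue_on \<Omega>. (a * f x + b * g x) * h x)
      = (LINT x|lebesgue_on \<Omega>. a * (f x * h x) + b * (g x * h x))"
    by (simp add: algebra_simps)
  also have "\<dots> = a * (LINT x|lebesgue_on \<Omega>. f x * h x) + b * (LINT x|lebesgue_on \<Omega>. g x * h x)"
    using int[OF f h] int[OF g h] by simp
  finally show "(LINT x|lebesgue_on \<Omega>. (a * f x + b * g x) * h x)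
      = a * (LINT x|lebesgue_on \<Omega>. f x * h x) + b * (LINT x|lebesgue_on \<Omega>. g x * h x)" .
qed (rule Vh_real_finite_dim[OF T])

section \<open>The projection and the discrete Laplacian\<close>

lemma Vh_real_in_L2: "f \<in> Vh_real \<Omega> \<T> l \<Longrightarrow> f \<in> L2 \<Omega>"
  by (simp add: Vh_real_def H10_def)

lemma Vh_complexI:
  assumes "f \<in> Vh_real \<Omega> \<T> l" "g \<in> Vh_real \<Omega> \<T> l"
  shows "(\<lambda>x. complex_of_real (f x) + \<i> * complex_of_real (g x)) \<in> Vh_complex \<Omega> \<T> l"
  using assms unfolding Vh_complex_def by blast

lemma Vh_complex_cases:
  assumes "w \<in> Vh_complex \<Omega> \<T> l"
  obtains f g where "f \<in> Vh_real \<Omega> \<T> l" "g \<in> Vh_real \<Omega> \<T> l"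
    "w = (\<lambda>x. complex_of_real (f x) + \<i> * complex_of_real (g x))"
  using assms unfolding Vh_complex_def by blast

lemma Vh_complex_in_L2:
  assumes "w \<in> Vh_complex \<Omega> \<T> l"
  shows "w \<in> L2 \<Omega>"
  using assms by (elim Vh_complex_cases) (simp add: L2_complex_combination Vh_real_in_L2)

lemma integral_complex_combination_mult_of_real:
  assumes "u \<in> L2 \<Omega>" "v \<in> L2 \<Omega>" "f \<in> L2 \<Omega>"
  shows "(LINT x|lebesgue_on \<Omega>. (complex_of_real (u x) + \<i> * complex_of_real (v x)) * complex_of_real (f x))
    = complex_of_real (LINT x|lebesgue_on \<Omega>. u x * f x) + \<i> * complex_of_real (LINT x|lebesgue_on \<Omega>. v x * f x)"
proof -
  have "(LINT x|lebesgue_on \<Omega>. (complex_of_real (u x) + \<i> * complex_of_real (v x)) * complex_of_real (f x))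
    = (LINT x|lebesgue_on \<Omega>. complex_of_real (u x * f x) + \<i> * complex_of_real (v x * f x))"
    by (simp add: algebra_simps)
  also have "\<dots> = (LINT x|lebesgue_on \<Omega>. complex_of_real (u x * f x))
      + (LINT x|lebesgue_on \<Omega>. \<i> * complex_of_real (v x * f x))"
    using assms by (intro Bochner_Integration.integral_add integrable_mult_right integrable_of_real L2_integrable_mult)
  finally show ?thesis
    by (simp only: integral_mult_right_zero integral_complex_of_real)
qed

text \<open>The real and imaginary parts of \<open>L\<close> are represented separately. Unique
  existence is exactly what the \<open>THE\<close> in \<open>Ph\<close> and
  \<open>neg_Laplace_h\<close> calls for, so both operators are instances of this.\<close>

lemma Vh_complex_riesz_representation:
  fixes \<Omega> :: "(real^'d) set"
  assumes \<Omega>: "open \<Omega>" "bounded \<Omega>" and T: "conforming_partition \<Omega> \<T>"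
    and L: "\<And>a b f g. f \<in> Vh_real \<Omega> \<T> l \<Longrightarrow> g \<in> Vh_real \<Omega> \<T> l \<Longrightarrow>
      L (\<lambda>x. a * f x + b * g x) = complex_of_real a * L f + complex_of_real b * L g"
  shows "\<exists>!w. w \<in> Vh_complex \<Omega> \<T> l \<and>
    (\<forall>f \<in> Vh_real \<Omega> \<T> l. (LINT x|lebesgue_on \<Omega>. w x * complex_of_real (f x)) = L f)"
proof -
  interpret finite_dim_inner_product "Vh_real \<Omega> \<T> l" "\<lambda>f g. LINT x|lebesgue_on \<Omega>. f x * g x"
    by (rule Vh_real_finite_dim_inner_product[OF \<Omega> T])
  note int = integral_complex_combination_mult_of_real[OF Vh_real_in_L2 Vh_real_in_L2 Vh_real_in_L2]
  obtain u where u: "u \<in> Vh_real \<Omega> \<T> l"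
      "\<And>f. f \<in> Vh_real \<Omega> \<T> l \<Longrightarrow> (LINT x|lebesgue_on \<Omega>. u x * f x) = Re (L f)"
    using riesz_representation[of "\<lambda>f. Re (L f)"] by (auto simp: L)
  obtain v where v: "v \<in> Vh_real \<Omega> \<T> l"
      "\<And>f. f \<in> Vh_real \<Omega> \<T> l \<Longrightarrow> (LINT x|lebesgue_on \<Omega>. v x * f x) = Im (L f)"
    using riesz_representation[of "\<lambda>f. Im (L f)"] by (auto simp: L)
  show ?thesis
  proof (rule ex1I)
    show "(\<lambda>x. complex_of_real (u x) + \<i> * complex_of_real (v x)) \<in> Vh_complex \<Omega> \<T> l \<and>
      (\<forall>f \<in> Vh_real \<Omega> \<T> l. (LINT x|lebesgue_on \<Omega>.
        (complex_of_real (u x) + \<i> * complex_of_real (v x)) * complex_of_real (f x)) = L f)"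
      using u v int[OF u(1) v(1)] unfolding Vh_complex_def
      by (auto simp: complex_eq[symmetric])
    fix w
    assume w: "w \<in> Vh_complex \<Omega> \<T> l \<and>
      (\<forall>f \<in> Vh_real \<Omega> \<T> l. (LINT x|lebesgue_on \<Omega>. w x * complex_of_real (f x)) = L f)"
    then obtain u' v' where u': "u' \<in> Vh_real \<Omega> \<T> l" and v': "v' \<in> Vh_real \<Omega> \<T> l"
      and w_eq: "w = (\<lambda>x. complex_of_real (u' x) + \<i> * complex_of_real (v' x))"
      by (blast elim: Vh_complex_cases)
    have eq: "L f = complex_of_real (LINT x|lebesgue_on \<Omega>. u' x * f x)
        + \<i> * complex_of_real (LINT x|lebesgue_on \<Omega>. v' x * f x)" if "f \<in> Vh_real \<Omega> \<T> l" for f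
      using w that int[OF u' v' that] by (simp add: w_eq)
    have "u' = u" using eq by (intro eq_if_ip_eq u' u) (simp add: u(2))
    moreover have "v' = v" using eq by (intro eq_if_ip_eq v' v) (simp add: v(2))
    ultimately show "w = (\<lambda>x. complex_of_real (u x) + \<i> * complex_of_real (v x))"
      by (simp add: w_eq)
  qed
qed

lemma integral_mult_of_real_lincomb:
  fixes v :: "real^'d \<Rightarrow> complex" and f g :: "real^'d \<Rightarrow> real"
  assumes v: "v \<in> L2 \<Omega>" and fg: "f \<in> L2 \<Omega>" "g \<in> L2 \<Omega>"
  shows "(LINT x|lebesgue_on \<Omega>. v x * complex_of_real (a * f x + b * g x))
    = complex_of_real a * (LINT x|lebesgue_on \<Omega>. v x * complex_of_real (f x))
      + complex_of_real b * (LINT x|lebesgue_on \<Omega>. v x * complex_of_real (g x))"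
proof -
  have "(LINT x|lebesgue_on \<Omega>. v x * complex_of_real (a * f x + b * g x))
    = (LINT x|lebesgue_on \<Omega>. complex_of_real a * (v x * complex_of_real (f x))
        + complex_of_real b * (v x * complex_of_real (g x)))"
    by (simp add: algebra_simps)
  also have "\<dots> = (LINT x|lebesgue_on \<Omega>. complex_of_real a * (v x * complex_of_real (f x)))
      + (LINT x|lebesgue_on \<Omega>. complex_of_real b * (v x * complex_of_real (g x)))"
    using assms by (intro Bochner_Integration.integral_add integrable_mult_right L2_integrable_mult_of_real)
  finally show ?thesis by (simp only: integral_mult_right_zero)
qed

section \<open>Defining equations of the two operators\<close>

lemma Ph_properties:
  fixes \<Omega> :: "(real^'d) set"
  assumes \<Omega>: "open \<Omega>" "bounded \<Omega>" and T: "conforming_partition \<Omega> \<T>" and v: "v \<in> L2 \<Omega>"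
  shows "Ph \<Omega> \<T> l v \<in> Vh_complex \<Omega> \<T> l"
    and "\<And>f. f \<in> Vh_real \<Omega> \<T> l \<Longrightarrow>
      (LINT x|lebesgue_on \<Omega>. Ph \<Omega> \<T> l v x * complex_of_real (f x))
        = (LINT x|lebesgue_on \<Omega>. v x * complex_of_real (f x))"
proof -
  have "\<exists>!w. w \<in> Vh_complex \<Omega> \<T> l \<and> (\<forall>f \<in> Vh_real \<Omega> \<T> l.
      (LINT x|lebesgue_on \<Omega>. w x * complex_of_real (f x)) = (LINT x|lebesgue_on \<Omega>. v x * complex_of_real (f x)))"
    by (intro Vh_complex_riesz_representation[OF \<Omega> T] integral_mult_of_real_lincomb v Vh_real_in_L2)
  from theI'[OF this] show "Ph \<Omega> \<T> l v \<in> Vh_complex \<Omega> \<T> l"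
    and "\<And>f. f \<in> Vh_real \<Omega> \<T> l \<Longrightarrow>
      (LINT x|lebesgue_on \<Omega>. Ph \<Omega> \<T> l v x * complex_of_real (f x))
        = (LINT x|lebesgue_on \<Omega>. v x * complex_of_real (f x))"
    unfolding Ph_def by blast+
qed

lemma has_weak_gradient_weak_gradient:
  "has_weak_gradient \<Omega> v g \<Longrightarrow> has_weak_gradient \<Omega> v (weak_gradient \<Omega> v)"
  unfolding weak_gradient_def by (rule someI[of "has_weak_gradient \<Omega> v"])

lemma Vh_real_has_weak_gradient:
  assumes "f \<in> Vh_real \<Omega> \<T> l"
  shows "has_weak_gradient \<Omega> f (weak_gradient \<Omega> f)"
  using assms has_weak_gradient_weak_gradient by (auto simp: Vh_real_def H10_def)

text \<open>\<open>weak_gradient\<close> is an arbitrary choice, so its compatibility with real and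
  imaginary parts comes from uniqueness and holds only almost everywhere.\<close>

lemma weak_gradient_Vh_complex:
  fixes f g :: "real^'d \<Rightarrow> real"
  assumes \<Omega>: "open \<Omega>" "bounded \<Omega>" and f: "f \<in> Vh_real \<Omega> \<T> l" and g: "g \<in> Vh_real \<Omega> \<T> l"
  defines "v \<equiv> \<lambda>x. complex_of_real (f x) + \<i> * complex_of_real (g x)"
  shows "has_weak_gradient \<Omega> v (weak_gradient \<Omega> v)"
    and "AE x in lebesgue_on \<Omega>. \<forall>i. weak_gradient \<Omega> v x $ i
      = complex_of_real (weak_gradient \<Omega> f x $ i) + \<i> * complex_of_real (weak_gradient \<Omega> g x $ i)"
proof -
  have w: "has_weak_gradient \<Omega> v
      (\<lambda>x. \<chi> i. complex_of_real (weak_gradient \<Omega> f x $ i) + \<i> * complex_of_real (weak_gradient \<Omega> g x $ i))"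
    unfolding v_def using f g
    by (intro has_weak_gradient_complex[OF \<Omega>] Vh_real_in_L2 Vh_real_has_weak_gradient)
  then show *: "has_weak_gradient \<Omega> v (weak_gradient \<Omega> v)"
    by (rule has_weak_gradient_weak_gradient)
  show "AE x in lebesgue_on \<Omega>. \<forall>i. weak_gradient \<Omega> v x $ i
      = complex_of_real (weak_gradient \<Omega> f x $ i) + \<i> * complex_of_real (weak_gradient \<Omega> g x $ i)"
    using has_weak_gradient_unique[OF \<Omega> * w] by eventually_elim simp
qed

lemma integrable_gradient_product:
  fixes v :: "real^'d \<Rightarrow> complex" and f :: "real^'d \<Rightarrow> real"
  assumes "has_weak_gradient \<Omega> v G" "has_weak_gradient \<Omega> f F"
  shows "integrable (lebesgue_on \<Omega>) (\<lambda>x. \<Sum>i\<in>UNIV. G x $ i * complex_of_real (F x $ i))"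
  using assms by (intro Bochner_Integration.integrable_sum L2_integrable_mult_of_real)
    (auto simp: has_weak_gradient_def)

text \<open>The right-hand side must be linear in \<open>f\<close> although the gradient of each
  \<open>f\<close> is chosen independently. Uniqueness makes the integrands agree almost everywhere,
  which suffices for the integrals.\<close>

lemma neg_Laplace_h_properties:
  fixes \<Omega> :: "(real^'d) set" and v :: "real^'d \<Rightarrow> complex"
  assumes \<Omega>: "open \<Omega>" "bounded \<Omega>" and T: "conforming_partition \<Omega> \<T>"
    and v: "has_weak_gradient \<Omega> v (weak_gradient \<Omega> v)"
  shows "neg_Laplace_h \<Omega> \<T> l v \<in> Vh_complex \<Omega> \<T> l"
    and "\<And>f. f \<in> Vh_real \<Omega> \<T> l \<Longrightarrow>
      (LINT x|lebesgue_on \<Omega>. neg_Laplace_h \<Omega> \<T> l v x * complex_of_real (f x))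
        = (LINT x|lebesgue_on \<Omega>. (\<Sum>i\<in>UNIV. weak_gradient \<Omega> v x $ i * complex_of_real (weak_gradient \<Omega> f x $ i)))"
proof -
  let ?G = "weak_gradient \<Omega> v"
  let ?L = "\<lambda>f. LINT x|lebesgue_on \<Omega>. (\<Sum>i\<in>UNIV. ?G x $ i * complex_of_real (weak_gradient \<Omega> f x $ i))"
  have lin: "?L (\<lambda>x. a * f x + b * g x) = complex_of_real a * ?L f + complex_of_real b * ?L g"
    if f: "f \<in> Vh_real \<Omega> \<T> l" and g: "g \<in> Vh_real \<Omega> \<T> l" for a b f g
  proof -
    let ?h = "\<lambda>x. a * f x + b * g x"
    note F = Vh_real_has_weak_gradient[OF f] and G = Vh_real_has_weak_gradient[OF g]
    have h: "?h \<in> Vh_real \<Omega> \<T> l" by (rule Vh_real_lincomb[OF \<Omega> f g])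
    note H = Vh_real_has_weak_gradient[OF h]
    have "has_weak_gradient \<Omega> ?h (\<lambda>x. a *\<^sub>R weak_gradient \<Omega> f x + b *\<^sub>R weak_gradient \<Omega> g x)"
      using has_weak_gradient_linear[OF \<Omega> Vh_real_in_L2[OF f] Vh_real_in_L2[OF g] F G, of a b] by simp
    from has_weak_gradient_unique[OF \<Omega> H this]
    have ae: "AE x in lebesgue_on \<Omega>. (\<Sum>i\<in>UNIV. ?G x $ i * complex_of_real (weak_gradient \<Omega> ?h x $ i))
      = complex_of_real a * (\<Sum>i\<in>UNIV. ?G x $ i * complex_of_real (weak_gradient \<Omega> f x $ i))
        + complex_of_real b * (\<Sum>i\<in>UNIV. ?G x $ i * complex_of_real (weak_gradient \<Omega> g x $ i))"
      by eventually_elim (simp add: sum_distrib_left sum.distrib algebra_simps)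
    have i: "integrable (lebesgue_on \<Omega>) (\<lambda>x. complex_of_real a * (\<Sum>i\<in>UNIV. ?G x $ i * complex_of_real (weak_gradient \<Omega> f x $ i)))"
        "integrable (lebesgue_on \<Omega>) (\<lambda>x. complex_of_real b * (\<Sum>i\<in>UNIV. ?G x $ i * complex_of_real (weak_gradient \<Omega> g x $ i)))"
      by (intro integrable_mult_right integrable_gradient_product[OF v F] integrable_gradient_product[OF v G])+
    have "?L ?h = (LINT x|lebesgue_on \<Omega>. complex_of_real a * (\<Sum>i\<in>UNIV. ?G x $ i * complex_of_real (weak_gradient \<Omega> f x $ i))
        + complex_of_real b * (\<Sum>i\<in>UNIV. ?G x $ i * complex_of_real (weak_gradient \<Omega> g x $ i)))"
      using integrable_gradient_product[OF v H] i ae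
      by (intro integral_cong_AE) (auto intro: borel_measurable_integrable)
    also have "\<dots> = complex_of_real a * ?L f + complex_of_real b * ?L g"
      by (simp only: Bochner_Integration.integral_add[OF i] integral_mult_right_zero)
    finally show ?thesis .
  qed
  have "\<exists>!w. w \<in> Vh_complex \<Omega> \<T> l \<and> (\<forall>f \<in> Vh_real \<Omega> \<T> l.
      (LINT x|lebesgue_on \<Omega>. w x * complex_of_real (f x)) = ?L f)"
    by (rule Vh_complex_riesz_representation[OF \<Omega> T lin])
  from theI'[OF this] show "neg_Laplace_h \<Omega> \<T> l v \<in> Vh_complex \<Omega> \<T> l"
    and "\<And>f. f \<in> Vh_real \<Omega> \<T> l \<Longrightarrow>
      (LINT x|lebesgue_on \<Omega>. neg_Laplace_h \<Omega> \<T> l v x * complex_of_real (f x)) = ?L f"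
    unfolding neg_Laplace_h_def by blast+
qed

section \<open>Testing with the conjugate of a finite element function\<close>

text \<open>This passes from the real test functions of the defining equations to the conjugate of a
  complex one.\<close>

lemma integral_mult_cnj:
  fixes w :: "real^'d \<Rightarrow> complex"
  assumes w: "w \<in> L2 \<Omega>" and fg: "f \<in> L2 \<Omega>" "g \<in> L2 \<Omega>"
  shows "(LINT x|lebesgue_on \<Omega>. w x * cnj (complex_of_real (f x) + \<i> * complex_of_real (g x)))
    = (LINT x|lebesgue_on \<Omega>. w x * complex_of_real (f x)) - \<i> * (LINT x|lebesgue_on \<Omega>. w x * complex_of_real (g x))"
proof -
  have "(LINT x|lebesgue_on \<Omega>. w x * cnj (complex_of_real (f x) + \<i> * complex_of_real (g x)))
    = (LINT x|lebesgue_on \<Omega>. w x * complex_of_real (f x) - \<i> * (w x * complex_of_real (g x)))"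
    by (simp add: algebra_simps)
  also have "\<dots> = (LINT x|lebesgue_on \<Omega>. w x * complex_of_real (f x))
      - (LINT x|lebesgue_on \<Omega>. \<i> * (w x * complex_of_real (g x)))"
    using assms by (intro Bochner_Integration.integral_diff integrable_mult_right L2_integrable_mult_of_real)
  finally show ?thesis by (simp only: integral_mult_right_zero)
qed

lemma neg_Laplace_h_inner_real:
  fixes \<Omega> :: "(real^'d) set"
  assumes \<Omega>: "open \<Omega>" "bounded \<Omega>" and T: "conforming_partition \<Omega> \<T>"
    and v: "v \<in> Vh_complex \<Omega> \<T> l"
  shows "Im (LINT x|lebesgue_on \<Omega>. neg_Laplace_h \<Omega> \<T> l v x * cnj (v x)) = 0"
proof -
  obtain f g where f: "f \<in> Vh_real \<Omega> \<T> l" and g: "g \<in> Vh_real \<Omega> \<T> l"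
    and v_eq: "v = (\<lambda>x. complex_of_real (f x) + \<i> * complex_of_real (g x))"
    using v by (rule Vh_complex_cases)
  let ?G = "weak_gradient \<Omega> v" and ?F = "weak_gradient \<Omega> f" and ?H = "weak_gradient \<Omega> g"
  note V = weak_gradient_Vh_complex[OF \<Omega> f g, folded v_eq]
  note int = integrable_gradient_product[OF V(1) Vh_real_has_weak_gradient[OF f]]
    integrable_mult_right[OF integrable_gradient_product[OF V(1) Vh_real_has_weak_gradient[OF g]], of \<i>]
  note P = neg_Laplace_h_properties[OF \<Omega> T V(1), where l = l]
  have "(LINT x|lebesgue_on \<Omega>. neg_Laplace_h \<Omega> \<T> l v x * cnj (v x))
    = (LINT x|lebesgue_on \<Omega>. neg_Laplace_h \<Omega> \<T> l v x * complex_of_real (f x))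
      - \<i> * (LINT x|lebesgue_on \<Omega>. neg_Laplace_h \<Omega> \<T> l v x * complex_of_real (g x))"
    using integral_mult_cnj[OF Vh_complex_in_L2[OF P(1)] Vh_real_in_L2[OF f] Vh_real_in_L2[OF g]]
    by (simp add: v_eq)
  also have "\<dots> = (LINT x|lebesgue_on \<Omega>. (\<Sum>i\<in>UNIV. ?G x $ i * complex_of_real (?F x $ i)))
      - (LINT x|lebesgue_on \<Omega>. \<i> * (\<Sum>i\<in>UNIV. ?G x $ i * complex_of_real (?H x $ i)))"
    by (simp only: P(2)[OF f] P(2)[OF g] integral_mult_right_zero)
  also have "\<dots> = (LINT x|lebesgue_on \<Omega>. (\<Sum>i\<in>UNIV. ?G x $ i * complex_of_real (?F x $ i))
      - \<i> * (\<Sum>i\<in>UNIV. ?G x $ i * complex_of_real (?H x $ i)))" (is "_ = (LINT x|_. ?I x)")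
    using int by (rule Bochner_Integration.integral_diff[symmetric])
  also have "\<dots> = (LINT x|lebesgue_on \<Omega>. complex_of_real (\<Sum>i\<in>UNIV. (?F x $ i)\<^sup>2 + (?H x $ i)\<^sup>2))"
  proof (rule integral_cong_AE)
    \<comment> \<open>Almost everywhere G = F + i H, and (F + i H) F - i (F + i H) H = F^2 + H^2 in
      each component, since the mixed terms cancel.\<close>
    show "AE x in lebesgue_on \<Omega>. ?I x = complex_of_real (\<Sum>i\<in>UNIV. (?F x $ i)\<^sup>2 + (?H x $ i)\<^sup>2)"
      using V(2)
      by eventually_elim
        (simp add: sum_distrib_left sum_subtractf[symmetric] algebra_simps power2_eq_square)
    show "?I \<in> borel_measurable (lebesgue_on \<Omega>)"
      by (rule borel_measurable_integrable[OF Bochner_Integration.integrable_diff[OF int]])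
    have [measurable]: "(\<lambda>x. ?F x $ i) \<in> borel_measurable (lebesgue_on \<Omega>)"
      "(\<lambda>x. ?H x $ i) \<in> borel_measurable (lebesgue_on \<Omega>)" for i
      using Vh_real_has_weak_gradient[OF f] Vh_real_has_weak_gradient[OF g]
      by (auto simp: has_weak_gradient_def L2_def)
    show "(\<lambda>x. complex_of_real (\<Sum>i\<in>UNIV. (?F x $ i)\<^sup>2 + (?H x $ i)\<^sup>2)) \<in> borel_measurable (lebesgue_on \<Omega>)"
      by measurable
  qed
  also have "\<dots> = complex_of_real (LINT x|lebesgue_on \<Omega>. (\<Sum>i\<in>UNIV. (?F x $ i)\<^sup>2 + (?H x $ i)\<^sup>2))"
    by (rule integral_complex_of_real)
  finally show ?thesis by simp
qed

lemma Ph_potential_inner_real: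
  fixes \<Omega> :: "(real^'d) set" and \<Phi> :: "real^'d \<Rightarrow> real"
  assumes \<Omega>: "open \<Omega>" "bounded \<Omega>" and T: "conforming_partition \<Omega> \<T>"
    and v: "v \<in> Vh_complex \<Omega> \<T> l" and \<Phi>v: "(\<lambda>x. complex_of_real (\<Phi> x) * v x) \<in> L2 \<Omega>"
  shows "Im (LINT x|lebesgue_on \<Omega>. Ph \<Omega> \<T> l (\<lambda>y. complex_of_real (\<Phi> y) * v y) x * cnj (v x)) = 0"
proof -
  obtain f g where f: "f \<in> Vh_real \<Omega> \<T> l" and g: "g \<in> Vh_real \<Omega> \<T> l"
    and v_eq: "v = (\<lambda>x. complex_of_real (f x) + \<i> * complex_of_real (g x))"
    using v by (rule Vh_complex_cases)
  note P = Ph_properties[OF \<Omega> T \<Phi>v, where l = l]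
  have "(LINT x|lebesgue_on \<Omega>. Ph \<Omega> \<T> l (\<lambda>y. complex_of_real (\<Phi> y) * v y) x * cnj (v x))
    = (LINT x|lebesgue_on \<Omega>. complex_of_real (\<Phi> x) * v x * cnj (v x))"
    using integral_mult_cnj[OF Vh_complex_in_L2[OF P(1)] Vh_real_in_L2[OF f] Vh_real_in_L2[OF g]]
      integral_mult_cnj[OF \<Phi>v Vh_real_in_L2[OF f] Vh_real_in_L2[OF g]] P(2)[OF f] P(2)[OF g]
    by (simp add: fun_cong[OF v_eq, symmetric])
  also have "\<dots> = (LINT x|lebesgue_on \<Omega>. complex_of_real (\<Phi> x * (cmod (v x))\<^sup>2))"
    by (simp only: of_real_mult complex_norm_square mult.assoc)
  also have "\<dots> = complex_of_real (LINT x|lebesgue_on \<Omega>. \<Phi> x * (cmod (v x))\<^sup>2)"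
    by (rule integral_complex_of_real)
  finally show ?thesis by simp
qed

section \<open>Mass balance\<close>

lemma Vh_complex_lincomb:
  assumes \<Omega>: "open \<Omega>" "bounded \<Omega>" and u: "u \<in> Vh_complex \<Omega> \<T> l" and w: "w \<in> Vh_complex \<Omega> \<T> l"
  shows "(\<lambda>x. complex_of_real a * u x + complex_of_real b * w x) \<in> Vh_complex \<Omega> \<T> l"
proof -
  obtain f g where f: "f \<in> Vh_real \<Omega> \<T> l" and g: "g \<in> Vh_real \<Omega> \<T> l"
    and u_eq: "u = (\<lambda>x. complex_of_real (f x) + \<i> * complex_of_real (g x))"
    using u by (rule Vh_complex_cases)
  obtain f' g' where f': "f' \<in> Vh_real \<Omega> \<T> l" and g': "g' \<in> Vh_real \<Omega> \<T> l"
    and w_eq: "w = (\<lambda>x. complex_of_real (f' x) + \<i> * complex_of_real (g' x))"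
    using w by (rule Vh_complex_cases)
  have "(\<lambda>x. complex_of_real a * u x + complex_of_real b * w x)
    = (\<lambda>x. complex_of_real (a * f x + b * f' x) + \<i> * complex_of_real (a * g x + b * g' x))"
    by (simp add: u_eq w_eq fun_eq_iff algebra_simps)
  then show ?thesis
    using Vh_complexI[OF Vh_real_lincomb[OF \<Omega> f f'] Vh_real_lincomb[OF \<Omega> g g']] by (simp only:)
qed

lemma Umid_in_Vh_complex:
  assumes \<Omega>: "open \<Omega>" "bounded \<Omega>" and U: "U n \<in> Vh_complex \<Omega> \<T> l" "U (Suc n) \<in> Vh_complex \<Omega> \<T> l"
  shows "Umid U n \<in> Vh_complex \<Omega> \<T> l"
proof -
  have "Umid U n = (\<lambda>x. complex_of_real (1 / 2) * U (Suc n) x + complex_of_real (1 / 2) * U n x)"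
    by (simp add: Umid_def fun_eq_iff field_simps)
  then show ?thesis using Vh_complex_lincomb[OF \<Omega> U(2,1), of "1 / 2" "1 / 2"] by (simp only:)
qed

text \<open>A product of two square-integrable functions need not be square-integrable; here all
  factors are continuous on the compact closure.\<close>

lemma potential_mult_Vh_complex_in_L2:
  assumes \<Omega>: "open \<Omega>" "bounded \<Omega>" and \<Phi>: "\<Phi> \<in> Vh_real \<Omega> \<T> l" and v: "v \<in> Vh_complex \<Omega> \<T> l"
  shows "(\<lambda>x. complex_of_real (\<Phi> x) * v x) \<in> L2 \<Omega>"
proof -
  obtain f g where f: "f \<in> Vh_real \<Omega> \<T> l" and g: "g \<in> Vh_real \<Omega> \<T> l"
    and v_eq: "v = (\<lambda>x. complex_of_real (f x) + \<i> * complex_of_real (g x))"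
    using v by (rule Vh_complex_cases)
  have "continuous_on (closure \<Omega>) \<Phi>" "continuous_on (closure \<Omega>) f" "continuous_on (closure \<Omega>) g"
    using \<Phi> f g by (auto simp: Vh_real_def)
  then show ?thesis
    unfolding v_eq by (intro continuous_on_closure_in_L2 \<Omega> continuous_intros)
qed

lemma L2_integrable_mult_cnj:
  fixes u v :: "real^'d \<Rightarrow> complex"
  assumes u: "u \<in> L2 \<Omega>" and v: "v \<in> L2 \<Omega>"
  shows "integrable (lebesgue_on \<Omega>) (\<lambda>x. u x * cnj (v x))"
proof (rule L2_integrable_product[OF u v])
  have m: "u \<in> borel_measurable (lebesgue_on \<Omega>)" "v \<in> borel_measurable (lebesgue_on \<Omega>)"
    using u v by (auto simp: L2_def)
  have "(\<lambda>x. cnj (v x)) \<in> borel_measurable (lebesgue_on \<Omega>)"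
    by (rule borel_measurable_continuous_on[OF _ m(2)]) (intro continuous_intros)
  with m(1) show "(\<lambda>x. u x * cnj (v x)) \<in> borel_measurable (lebesgue_on \<Omega>)"
    by (rule borel_measurable_times)
qed (simp add: norm_mult)

theorem lemma3p1:
  fixes \<Omega> :: "(real^'d) set"
    and \<T> :: "(real^'d) set set"
    and \<sigma> T :: real
    and l N :: nat
    and p q r :: "real \<Rightarrow> real"
    and u0 :: "real^'d \<Rightarrow> complex"
    and t :: "nat \<Rightarrow> real"
    and k :: "int \<Rightarrow> real"
    and U :: "nat \<Rightarrow> real^'d \<Rightarrow> complex"
    and \<Phi> :: "int \<Rightarrow> real^'d \<Rightarrow> real"
  assumes dimension: "CARD('d) \<in> {1, 2, 3}"
    and domain: "open \<Omega>" "\<Omega> \<noteq> {}" "bounded \<Omega>" "convex \<Omega>" "polytope (closure \<Omega>)"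
    and mesh: "conforming_partition \<Omega> \<T>" "shape_regular \<sigma> \<T>"
    and degree: "l \<ge> 1"
    and final_time: "T > 0"
    and coefficients: "smooth_coefficient T p" "smooth_coefficient T q" "smooth_coefficient T r"
    and initial_value: "u0 \<in> H10 \<Omega>"
    and time_grid: "t 0 = 0" "\<forall>n<N. t n < t (Suc n)" "t N = T"
    and steps: "\<forall>n<N. k (int n) = t (Suc n) - t n" "k (- 1) = k 0"
    and scheme: "relaxation_scheme \<Omega> \<T> l p q r u0 N t k U \<Phi>"
  shows "\<forall>n<N. mass \<Omega> U (Suc n) =
           mass \<Omega> U n - 2 * k (int n) * r (tmid t n) * (L2norm \<Omega> (Umid U n))\<^sup>2"
proof (intro allI impI)
  fix n assume n: "n < N"
  note \<Omega> = domain(1,3)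
  let ?p = "p (tmid t n)" and ?q = "q (tmid t n)" and ?r = "r (tmid t n)" and ?k = "k (int n)"
  have k: "?k > 0" using n steps(1) time_grid(2) by simp
  have U: "U n \<in> Vh_complex \<Omega> \<T> l" "U (Suc n) \<in> Vh_complex \<Omega> \<T> l"
    and \<Phi>: "\<Phi> (int n) \<in> Vh_real \<Omega> \<T> l"
    using scheme n unfolding relaxation_scheme_def by auto
  define v where "v = Umid U n"
  define A where "A = neg_Laplace_h \<Omega> \<T> l v"
  define B where "B = Ph \<Omega> \<T> l (\<lambda>y. complex_of_real (\<Phi> (int n) y) * v y)"
  have v: "v \<in> Vh_complex \<Omega> \<T> l" unfolding v_def by (rule Umid_in_Vh_complex[OF \<Omega> U])
  have A: "A \<in> Vh_complex \<Omega> \<T> l"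
    unfolding A_def using v neg_Laplace_h_properties(1)[OF \<Omega> mesh(1)] weak_gradient_Vh_complex(1)[OF \<Omega>]
    by (auto elim: Vh_complex_cases)
  note \<Phi>v = potential_mult_Vh_complex_in_L2[OF \<Omega> \<Phi> v]
  have B: "B \<in> Vh_complex \<Omega> \<T> l"
    unfolding B_def by (rule Ph_properties(1)[OF \<Omega> mesh(1) \<Phi>v])
  \<comment> \<open>The scheme is solved for the increment, multiplied by the conjugate of
    \<open>v\<close> and reduced to real parts. As \<open>Laplace_h\<close> is minus
    \<open>A\<close>, the Laplacian enters with factor -i and the potential with i, and Re (-i z) =
    Im z while Re (i z) = - Im z.\<close>
  have pointwise: "(cmod (U (Suc n) x))\<^sup>2 - (cmod (U n x))\<^sup>2
      = 2 * ?k * (?p * Im (A x * cnj (v x)) - ?q * Im (B x * cnj (v x)) - ?r * (cmod (v x))\<^sup>2)" for x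
  proof -
    have "(U (Suc n) x - U n x) / complex_of_real ?k - \<i> * complex_of_real ?p * Laplace_h \<Omega> \<T> l v x
        - \<i> * complex_of_real ?q * B x + complex_of_real ?r * v x = 0"
      using scheme n unfolding relaxation_scheme_def v_def B_def by blast
    then have "U (Suc n) x - U n x = complex_of_real ?k *
        (- \<i> * complex_of_real ?p * A x + \<i> * complex_of_real ?q * B x - complex_of_real ?r * v x)"
      using k by (simp add: Laplace_h_def A_def[symmetric] field_simps)
    then have "(U (Suc n) x - U n x) * cnj (v x) = complex_of_real ?k *
        (- \<i> * complex_of_real ?p * A x + \<i> * complex_of_real ?q * B x - complex_of_real ?r * v x) * cnj (v x)"
      by (simp only:)
    also have "\<dots> = complex_of_real ?k *
        (- \<i> * complex_of_real ?p * (A x * cnj (v x)) + \<i> * complex_of_real ?q * (B x * cnj (v x))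
          - complex_of_real ?r * (v x * cnj (v x)))"
      by (simp add: algebra_simps)
    finally have "Re ((U (Suc n) x - U n x) * cnj (v x)) = Re \<dots>"
      by (rule arg_cong)
    also have "\<dots> = ?k * (?p * Im (A x * cnj (v x)) - ?q * Im (B x * cnj (v x)) - ?r * (cmod (v x))\<^sup>2)"
    proof -
      have "(cmod (v x))\<^sup>2 = Re (v x) * Re (v x) + Im (v x) * Im (v x)"
        unfolding cmod_power2 by (simp add: power2_eq_square)
      then show ?thesis by (simp add: algebra_simps)
    qed
    finally have "Re ((U (Suc n) x - U n x) * cnj (v x))
        = ?k * (?p * Im (A x * cnj (v x)) - ?q * Im (B x * cnj (v x)) - ?r * (cmod (v x))\<^sup>2)" .
    \<comment> \<open>The factor 2 cancels the 1/2 of the midpoint average, and the mixed terms are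
      purely imaginary.\<close>
    moreover have "2 * Re ((U (Suc n) x - U n x) * cnj (v x)) = (cmod (U (Suc n) x))\<^sup>2 - (cmod (U n x))\<^sup>2"
      unfolding cmod_power2 v_def Umid_def by (simp add: power2_eq_square field_simps)
    ultimately show ?thesis by simp
  qed
  note L = Vh_complex_in_L2[OF U(1)] Vh_complex_in_L2[OF U(2)] Vh_complex_in_L2[OF v]
  note int = L2_integrable_mult_cnj[OF Vh_complex_in_L2[OF A] L(3)] L2_integrable_mult_cnj[OF Vh_complex_in_L2[OF B] L(3)]
  have int2: "integrable (lebesgue_on \<Omega>) (\<lambda>x. (cmod (U n x))\<^sup>2)"
    "integrable (lebesgue_on \<Omega>) (\<lambda>x. (cmod (U (Suc n) x))\<^sup>2)"
    "integrable (lebesgue_on \<Omega>) (\<lambda>x. (cmod (v x))\<^sup>2)"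
    using L by (auto simp: L2_def)
  \<comment> \<open>The Laplacian and potential terms disappear only after integration; pointwise
    they need not vanish.\<close>
  have "(LINT x|lebesgue_on \<Omega>. Im (A x * cnj (v x))) = 0"
    using neg_Laplace_h_inner_real[OF \<Omega> mesh(1) v] int(1) by (simp only: A_def integral_Im)
  moreover have "(LINT x|lebesgue_on \<Omega>. Im (B x * cnj (v x))) = 0"
    using Ph_potential_inner_real[OF \<Omega> mesh(1) v \<Phi>v] int(2) by (simp only: B_def integral_Im)
  moreover have "mass \<Omega> U (Suc n) - mass \<Omega> U n
      = (LINT x|lebesgue_on \<Omega>. (cmod (U (Suc n) x))\<^sup>2 - (cmod (U n x))\<^sup>2)"
    using int2 by (simp add: mass_def L2norm_square)
  moreover have "\<dots> = 2 * ?k * (?p * (LINT x|lebesgue_on \<Omega>. Im (A x * cnj (v x)))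
      - ?q * (LINT x|lebesgue_on \<Omega>. Im (B x * cnj (v x))) - ?r * (LINT x|lebesgue_on \<Omega>. (cmod (v x))\<^sup>2))"
    unfolding pointwise using integrable_Im[OF int(1)] integrable_Im[OF int(2)] int2(3)
    by (simp del: times_complex.sel)
  ultimately show "mass \<Omega> U (Suc n) = mass \<Omega> U n - 2 * ?k * ?r * (L2norm \<Omega> (Umid U n))\<^sup>2"
    by (simp add: L2norm_square v_def)
qed

end
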